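(* Let $q,r\in\mathbb{C}\setminus\{0\}$ with $q^k\neq 1$ for all positive integers $k$ and $r\neq \pm q^k$ for all $k\in\mathbb{Z}$. For any $n\geq 3$, the antisymmetrizer $A_n=\gamma_n(S_n)$ of $\mathrm{BWM}(r,q)_n$ (where $S_n$ here denotes the symmetrizer of $\mathrm{BWM}(r,p)_n$, $p=-q^{-1}$) satisfies $$A_n=\frac{q^{n-1}}{[\![n]\!]}A_{n-1}\,b^-_{n-1,1}=\frac{q^{n-1}}{[\![n]\!]}A_{n-1}[1]\,b^-_{1,n-1}=\frac{q^{n-1}}{[\![n]\!]}a^-_{n-1,1}\,A_{n-1}=\frac{q^{n-1}}{[\![n]\!]}a^-_{1,n-1}\,A_{n-1}[1].$$
   Context: Let $q,r\in\mathbb{C}\setminus\{0\}$ with $q^k\neq1$ for all positive integers $k$ and $r\neq\pm q^k$ for all $k\in\mathbb{Z}$. Put $\hat q:=q-q^{-1}$ and $[\![k]\!]:=(q^k-q^{-k})/(q-q^{-1})$ for $k\in\mathbb{Z}$. For $n\ge 2$, the Birman--Wenzl--Murakami algebra $\mathrm{BWM}(r,q)_n$ is the unital $\mathbb{C}$-algebra generated by $g_i,e_i$, $i=1,\dots,n-1$, with relations (for all indices for which they make sense) $$g_ig_{i+1}g_i=g_{i+1}g_ig_{i+1},\qquad g_ig_j=g_jg_i\ \text{ for } |i-j|>1,$$ $$g_i^2=1+\hat q g_i-r^{-1}\hat q e_i,\qquad g_ie_i=e_ig_i=r^{-1}e_i,$$ $$g_ig_{i+1}e_i=e_{i+1}e_i,\qquad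 g_{i+1}g_ie_{i+1}=e_ie_{i+1}.$$ The algebra $\mathrm{BWM}(r,q)_{n}$ is naturally embedded into $\mathrm{BWM}(r,q)_{n+k}$, $k\ge0$, via $g_i\mapsto g_i$, $e_i\mapsto e_i$. Let $s:\mathrm{BWM}(r,q)_{n-1}\to\mathrm{BWM}(r,q)_{n}$ be the shift homomorphism $s(g_i)=g_{i+1}$, $s(e_i)=e_{i+1}$; write $b[1]:=s(b)$, so $A_{n-1}[1]=s(A_{n-1})$. The symmetrizer of $\mathrm{BWM}(r,q)_n$ ($n\ge2$) is the unique nonzero element $S_n$ with $S_n^2=S_n$ and $S_ng_i=qS_n$ for all $i=1,\dots,n-1$ (its existence and uniqueness are known). The symmetrizer of $\mathrm{BWM}(r,p)_n$, $p=-q^{-1}$, is defined in the same way with $q$ replaced by $p$ (note that $p,r$ satisfy the same standing assumptions as $q,r$, and $p-p^{-1}=q-q^{-1}$). The map $\gamma_n:\mathrm{BWM}(r,p)_n\to\mathrm{BWM}(r,q)_n$ is the algebra isomorphism given by $\gamma_n(g_i)=g_i$, $\gamma_n(e_i)=e_i$. The antisymmetrizer $A_n$ ($n\ge2$) is the unique nonzero idempotent of $\mathrm{BWM}(r,q)_n$ with $A_ng_i=-q^{-1}A_n$ for all $i=1,\dots,n-1$. For $1\le i<k$ define $$d^-_{k,i}:=e_{k-1}e_{k-2}\cdots e_i\sum_{j=0}^{i-1}(-q)^{-j}\, g_{i-1}g_{i-2}\cdots g_{i-j},$$ $$d'^{-}_{k,i}:=e_1e_2\cdots e_{k-i}\sum_{j=0}^{i-1}(-q)^{-j}\,g_{k+1-i}g_{k+2-i}\cdots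 g_{k-i+j},$$ $$\bar d^{-}_{k,i}:=\sum_{j=0}^{i-1}(-q)^{-j}\,g_{i-j}\cdots g_{i-2}g_{i-1}\,e_ie_{i+1}\cdots e_{k-1},$$ $$\bar d'^{-}_{k,i}:=\sum_{j=0}^{i-1}(-q)^{-j}\,g_{k-i+j}\cdots g_{k-i+2}g_{k-i+1}\,e_{k-i}\cdots e_2e_1,$$ and for $0\le k<n$ define $$b^-_{k,1}:=\sum_{i=0}^k(-q)^{-i}\,g_kg_{k-1}\cdots g_{k+1-i}-\frac{\hat q}{1+q^{-2k+1}r}\sum_{i=1}^kq^{2i-2k-1}d^-_{k+1,i},$$ $$b^-_{1,k}:=\sum_{i=0}^k(-q)^{-i}\,g_1g_2\cdots g_i-\frac{\hat q}{1+q^{-2k+1}r}\sum_{i=1}^kq^{2i-2k-1}d'^{-}_{k+1,i},$$ $$a^-_{k,1}:=\sum_{i=0}^k(-q)^{-i}\,g_{k+1-i}\cdots g_{k-1}g_k-\frac{\hat q}{1+q^{-2k+1}r}\sum_{i=1}^kq^{2i-2k-1}\bar d^{-}_{k+1,i},$$ $$a^-_{1,k}:=\sum_{i=0}^k(-q)^{-i}\,g_i\cdots g_2g_1-\frac{\hat q}{1+q^{-2k+1}r}\sum_{i=1}^kq^{2i-2k-1}\bar d'^{-}_{k+1,i}.$$ In the inner sums over $j$ (in the definitions of the $d$'s) the product of $g$'s has $j$ factors; in the sums over $i$ with coefficient $(-q)^{-i}$ the product of $g$'s has $i$ factors; empty products equal $1$. *)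

theory Defs
  imports Complex_Main "HOL-Library.Poly_Mapping" "HOL-Algebra.QuotRing"
begin

section \<open>Free associative algebras\<close>

datatype bwm_letter = LG nat | LE nat

text \<open>
  The free monoid on the letters, written additively: over a (not necessarily commutative)
  monoid \<open>M\<close> in this form, the type \<open>M \<Rightarrow>\<^sub>0 complex\<close> of finitely supported functions
  with the convolution product of \<^theory>\<open>HOL-Library.Poly_Mapping\<close> is the monoid algebra, so
  \<open>bwm_word \<Rightarrow>\<^sub>0 complex\<close> is the free associative complex algebra on all letters.
\<close>

datatype bwm_word = Word (letters: "bwm_letter list")

instantiation bwm_word :: monoid_add
begin

definition zero_bwm_word :: bwm_word where
  "0 = Word []"

definition plus_bwm_word :: "bwm_word \<Rightarrow> bwm_word \<Rightarrow> bwm_word" where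
  "u + v = Word (letters u @ letters v)"

instance
  by standard (auto simp: zero_bwm_word_def plus_bwm_word_def)

end

type_synonym bwm_poly = "bwm_word \<Rightarrow>\<^sub>0 complex"

definition fconst :: "complex \<Rightarrow> bwm_poly" where
  "fconst c = Poly_Mapping.single 0 c"

definition fletter :: "bwm_letter \<Rightarrow> bwm_poly" where
  "fletter x = Poly_Mapping.single (Word [x]) 1"

abbreviation fg :: "nat \<Rightarrow> bwm_poly" where
  "fg i \<equiv> fletter (LG i)"

abbreviation fe :: "nat \<Rightarrow> bwm_poly" where
  "fe i \<equiv> fletter (LE i)"

definition bwm_letters :: "nat \<Rightarrow> bwm_letter set" where
  "bwm_letters n = LG ` {1..<n} \<union> LE ` {1..<n}"

definition free_alg :: "nat \<Rightarrow> bwm_poly ring" where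
  "free_alg n =
    \<lparr>carrier = {p. \<forall>w\<in>Poly_Mapping.keys p. set (letters w) \<subseteq> bwm_letters n},
     mult = (*), one = 1, zero = 0, add = (+)\<rparr>"

text \<open>The algebra endomorphism of the free algebra with prescribed values on the letters.\<close>

definition fsubst :: "(bwm_letter \<Rightarrow> bwm_poly) \<Rightarrow> bwm_poly \<Rightarrow> bwm_poly" where
  "fsubst \<phi> p =
    (\<Sum>w\<in>Poly_Mapping.keys p. fconst (Poly_Mapping.lookup p w) * prod_list (map \<phi> (letters w)))"


section \<open>Birman--Wenzl--Murakami algebras\<close>

definition qhat :: "complex \<Rightarrow> complex" where
  "qhat q = q - inverse q"

definition qnum :: "complex \<Rightarrow> int \<Rightarrow> complex" where
  "qnum q k = (q powi k - q powi (- k)) / (q - inverse q)"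

definition bwm_params :: "complex \<Rightarrow> complex \<Rightarrow> bool" where
  "bwm_params r q \<longleftrightarrow> q \<noteq> 0 \<and> r \<noteq> 0 \<and> (\<forall>k::nat. k > 0 \<longrightarrow> q ^ k \<noteq> 1) \<and>
     (\<forall>k::int. r \<noteq> q powi k \<and> r \<noteq> - (q powi k))"

text \<open>A relation \<open>x = y\<close> is represented by the element \<open>x - y\<close> of the free algebra.\<close>

definition bwm_relators :: "complex \<Rightarrow> complex \<Rightarrow> nat \<Rightarrow> bwm_poly set" where
  "bwm_relators r q n =
     {fg i * fg (i+1) * fg i - fg (i+1) * fg i * fg (i+1) | i. 1 \<le> i \<and> i + 1 < n}
   \<union> {fg i * fg j - fg j * fg i | i j. 1 \<le> i \<and> i < n \<and> 1 \<le> j \<and> j < n \<and> (i + 1 < j \<or> j + 1 < i)}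
   \<union> {fg i ^ 2 - (1 + fconst (qhat q) * fg i - fconst (inverse r * qhat q) * fe i) | i. 1 \<le> i \<and> i < n}
   \<union> {fg i * fe i - fe i * fg i | i. 1 \<le> i \<and> i < n}
   \<union> {fe i * fg i - fconst (inverse r) * fe i | i. 1 \<le> i \<and> i < n}
   \<union> {fg i * fg (i+1) * fe i - fe (i+1) * fe i | i. 1 \<le> i \<and> i + 1 < n}
   \<union> {fg (i+1) * fg i * fe (i+1) - fe i * fe (i+1) | i. 1 \<le> i \<and> i + 1 < n}"

definition bwm_ideal :: "complex \<Rightarrow> complex \<Rightarrow> nat \<Rightarrow> bwm_poly set" where
  "bwm_ideal r q n = genideal (free_alg n) (bwm_relators r q n)"

definition BWM :: "complex \<Rightarrow> complex \<Rightarrow> nat \<Rightarrow> bwm_poly set ring" where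
  "BWM r q n = free_alg n Quot bwm_ideal r q n"

definition bwm_class :: "complex \<Rightarrow> complex \<Rightarrow> nat \<Rightarrow> bwm_poly \<Rightarrow> bwm_poly set" where
  "bwm_class r q n p = bwm_ideal r q n +>\<^bsub>free_alg n\<^esub> p"

definition bwm_g :: "complex \<Rightarrow> complex \<Rightarrow> nat \<Rightarrow> nat \<Rightarrow> bwm_poly set" where
  "bwm_g r q n i = bwm_class r q n (fg i)"

definition bwm_e :: "complex \<Rightarrow> complex \<Rightarrow> nat \<Rightarrow> nat \<Rightarrow> bwm_poly set" where
  "bwm_e r q n i = bwm_class r q n (fe i)"

definition bwm_smult :: "complex \<Rightarrow> complex \<Rightarrow> nat \<Rightarrow> complex \<Rightarrow> bwm_poly set \<Rightarrow> bwm_poly set" where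
  "bwm_smult r q n c x = bwm_class r q n (fconst c) \<otimes>\<^bsub>BWM r q n\<^esub> x"

text \<open>
  The homomorphism into \<open>BWM r q n\<close> that sends the class of each letter \<open>x\<close> to the class of
  \<open>\<phi> x\<close>. Its argument is a coset \<open>X\<close> of the ideal of the source algebra, and \<open>J + f(X)\<close>
  is the coset of the target ideal \<open>J\<close> that contains the image of \<open>X\<close>; this is a single coset
  as soon as \<open>f\<close> maps the source ideal into \<open>J\<close> (see \<open>bwm_hom_class\<close> below).
\<close>

definition bwm_hom ::
    "complex \<Rightarrow> complex \<Rightarrow> nat \<Rightarrow> (bwm_letter \<Rightarrow> bwm_poly) \<Rightarrow> bwm_poly set \<Rightarrow> bwm_poly set" where
  "bwm_hom r q n \<phi> X = bwm_ideal r q n <+>\<^bsub>free_alg n\<^esub> (fsubst \<phi> ` X)"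

text \<open>\<open>bwm_embed r q n\<close> and \<open>bwm_shift r q n\<close> take values in \<open>BWM r q n\<close>.\<close>

definition bwm_embed :: "complex \<Rightarrow> complex \<Rightarrow> nat \<Rightarrow> bwm_poly set \<Rightarrow> bwm_poly set" where
  "bwm_embed r q n = bwm_hom r q n fletter"

primrec shift_letter :: "bwm_letter \<Rightarrow> bwm_letter" where
  "shift_letter (LG i) = LG (i + 1)"
| "shift_letter (LE i) = LE (i + 1)"

definition bwm_shift :: "complex \<Rightarrow> complex \<Rightarrow> nat \<Rightarrow> bwm_poly set \<Rightarrow> bwm_poly set" where
  "bwm_shift r q n = bwm_hom r q n (\<lambda>x. fletter (shift_letter x))"

text \<open>\<open>bwm_gamma r q n\<close> goes from \<open>BWM r (- inverse q) n\<close> to \<open>BWM r q n\<close>.\<close>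

definition bwm_gamma :: "complex \<Rightarrow> complex \<Rightarrow> nat \<Rightarrow> bwm_poly set \<Rightarrow> bwm_poly set" where
  "bwm_gamma r q n = bwm_hom r q n fletter"

definition symmetrizer :: "complex \<Rightarrow> complex \<Rightarrow> nat \<Rightarrow> bwm_poly set" where
  "symmetrizer r q n = (THE S. S \<in> carrier (BWM r q n) \<and> S \<noteq> \<zero>\<^bsub>BWM r q n\<^esub> \<and>
     S \<otimes>\<^bsub>BWM r q n\<^esub> S = S \<and>
     (\<forall>i\<in>{1..n-1}. S \<otimes>\<^bsub>BWM r q n\<^esub> bwm_g r q n i = bwm_smult r q n q S))"

definition antisymmetrizer :: "complex \<Rightarrow> complex \<Rightarrow> nat \<Rightarrow> bwm_poly set" where
  "antisymmetrizer r q n = (THE A. A \<in> carrier (BWM r q n) \<and> A \<noteq> \<zero>\<^bsub>BWM r q n\<^esub> \<and>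
     A \<otimes>\<^bsub>BWM r q n\<^esub> A = A \<and>
     (\<forall>i\<in>{1..n-1}. A \<otimes>\<^bsub>BWM r q n\<^esub> bwm_g r q n i = bwm_smult r q n (- inverse q) A))"


section \<open>Well-definedness of the algebras and homomorphisms\<close>

lemma carrier_free_alg_closed:
  assumes "p \<in> carrier (free_alg n)" "p' \<in> carrier (free_alg n)"
  shows "p + p' \<in> carrier (free_alg n)" "p * p' \<in> carrier (free_alg n)" "- p \<in> carrier (free_alg n)"
    "p - p' \<in> carrier (free_alg n)"
proof -
  show *: "p + p' \<in> carrier (free_alg n)" "- p \<in> carrier (free_alg n)"
    using assms Poly_Mapping.keys_add[of p p'] by (auto simp: free_alg_def)
  show "p * p' \<in> carrier (free_alg n)"
    using assms keys_mult[of p p'] by (fastforce simp: free_alg_def plus_bwm_word_def)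
  have "- p' \<in> carrier (free_alg n)"
    using assms by (auto simp: free_alg_def)
  then show "p - p' \<in> carrier (free_alg n)"
    using assms(1) Poly_Mapping.keys_add[of p "- p'"] by (auto simp: free_alg_def)
qed

lemma const_in_free_alg [simp]: "fconst c \<in> carrier (free_alg n)"
  by (auto simp: fconst_def free_alg_def zero_bwm_word_def)

lemma fconst_0: "fconst 0 = 0" and fconst_1: "fconst 1 = 1"
  by (simp_all add: fconst_def)

lemma zero_one_in_free_alg [simp]: "0 \<in> carrier (free_alg n)" "1 \<in> carrier (free_alg n)"
  using const_in_free_alg[of 0 n] const_in_free_alg[of 1 n] by (simp_all add: fconst_0 fconst_1)

lemma letter_in_free_alg: "x \<in> bwm_letters n \<Longrightarrow> fletter x \<in> carrier (free_alg n)"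
  by (auto simp: fletter_def free_alg_def)

lemma free_alg_simps:
  "mult (free_alg n) = (*)" "one (free_alg n) = 1" "zero (free_alg n) = 0" "add (free_alg n) = (+)"
  by (simp_all add: free_alg_def)

lemma ring_free_alg: "ring (free_alg n)"
proof (rule ringI)
  show "abelian_group (free_alg n)"
  proof (rule abelian_groupI)
    fix x assume "x \<in> carrier (free_alg n)"
    then show "\<exists>y\<in>carrier (free_alg n). y \<oplus>\<^bsub>free_alg n\<^esub> x = \<zero>\<^bsub>free_alg n\<^esub>"
      by (intro bexI[of _ "- x"]) (auto simp: free_alg_simps carrier_free_alg_closed)
  qed (auto simp: free_alg_simps carrier_free_alg_closed algebra_simps)
  show "monoid (free_alg n)"
    by (rule monoidI) (auto simp: free_alg_simps carrier_free_alg_closed algebra_simps)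
qed (auto simp: free_alg_simps algebra_simps)

lemma bwm_relators_subset: "bwm_relators r q n \<subseteq> carrier (free_alg n)"
proof -
  have [simp]: "fg i \<in> carrier (free_alg n)" "fe i \<in> carrier (free_alg n)" if "1 \<le> i" "i < n" for i
    using that by (auto intro!: letter_in_free_alg simp: bwm_letters_def)
  show ?thesis
    unfolding bwm_relators_def power2_eq_square
    by (auto intro!: carrier_free_alg_closed)
qed

lemma ideal_bwm_ideal: "ideal (bwm_ideal r q n) (free_alg n)"
  unfolding bwm_ideal_def
  by (rule ring.genideal_ideal[OF ring_free_alg bwm_relators_subset])

lemma ring_BWM: "ring (BWM r q n)"
  unfolding BWM_def by (rule ideal.quotient_is_ring[OF ideal_bwm_ideal])

lemma fsubst_superset:
  assumes "finite K" "Poly_Mapping.keys p \<subseteq> K"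
  shows "fsubst \<phi> p = (\<Sum>w\<in>K. fconst (Poly_Mapping.lookup p w) * prod_list (map \<phi> (letters w)))"
  unfolding fsubst_def using assms
  by (intro sum.mono_neutral_left) (auto simp: in_keys_iff fconst_0)

lemma fconst_add: "fconst (a + b) = fconst a + fconst b"
  by (simp add: fconst_def single_add)

lemma fconst_mult: "fconst (a * b) = fconst a * fconst b"
  by (simp add: fconst_def mult_single)

lemma poly_mapping_sum_induct [case_names single sum]:
  fixes p :: "'a \<Rightarrow>\<^sub>0 'b::comm_monoid_add"
  assumes single: "\<And>k v. P (Poly_Mapping.single k v)" and sum: "\<And>p p'. P p \<Longrightarrow> P p' \<Longrightarrow> P (p + p')"
  shows "P p"
proof (induction p rule: update_induct)
  case const
  show ?case using single[of undefined 0] by simp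
next
  case (update f k v)
  have "Poly_Mapping.update k v f = f + Poly_Mapping.single k v"
    using update by (intro poly_mapping_eqI) (auto simp: lookup_update lookup_add lookup_single in_keys_iff when_def)
  then show ?case using update sum single by simp
qed

lemma fconst_commute: "fconst c * p = p * fconst c"
proof (induction p rule: poly_mapping_sum_induct)
  case (single k v) then show ?case by (simp add: fconst_def mult_single mult.commute)
next
  case (sum p q) then show ?case by (simp add: algebra_simps)
qed

lemma fsubst_add: "fsubst \<phi> (p + p') = fsubst \<phi> p + fsubst \<phi> p'"
proof -
  let ?K = "Poly_Mapping.keys p \<union> Poly_Mapping.keys p'"
  have "Poly_Mapping.keys (p + p') \<subseteq> ?K" by (rule Poly_Mapping.keys_add)
  then show ?thesis
    by (simp add: fsubst_superset[of ?K] lookup_add fconst_add distrib_right sum.distrib)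
qed

lemma fsubst_single: "fsubst \<phi> (Poly_Mapping.single w c) = fconst c * prod_list (map \<phi> (letters w))"
  by (subst fsubst_superset[of "{w}"]) auto

lemma fsubst_mult: "fsubst \<phi> (p * p') = fsubst \<phi> p * fsubst \<phi> p'"
proof (induction p rule: poly_mapping_sum_induct)
  case (single k v)
  show ?case
  proof (induction p' rule: poly_mapping_sum_induct)
    case (single k' v')
    have "fconst v * (fconst v' * (prod_list (map \<phi> (letters k)) * prod_list (map \<phi> (letters k')))) =
      fconst v * (prod_list (map \<phi> (letters k)) * (fconst v' * prod_list (map \<phi> (letters k'))))"
      by (metis fconst_commute mult.assoc)
    then show ?case
      by (simp add: mult_single fsubst_single fconst_mult plus_bwm_word_def mult.assoc)
  qed (simp add: distrib_left fsubst_add)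
qed (simp add: distrib_right fsubst_add)

lemma fsubst_fletter [simp]: "fsubst \<phi> (fletter x) = \<phi> x"
  by (simp add: fletter_def fsubst_single fconst_1)

lemma fsubst_fconst [simp]: "fsubst \<phi> (fconst c) = fconst c"
  by (simp add: fconst_def fsubst_single zero_bwm_word_def)

lemma fsubst_0 [simp]: "fsubst \<phi> 0 = 0" and fsubst_1 [simp]: "fsubst \<phi> 1 = 1"
  using fsubst_fconst[of \<phi> 0] fsubst_fconst[of \<phi> 1] by (simp_all only: fconst_0 fconst_1)

lemma fsubst_uminus: "fsubst \<phi> (- p) = - fsubst \<phi> p"
  using fsubst_add[of \<phi> p "- p"] by (simp add: eq_neg_iff_add_eq_0 add.commute)

lemma fsubst_diff: "fsubst \<phi> (p - p') = fsubst \<phi> p - fsubst \<phi> p'"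
  using fsubst_add[of \<phi> p "- p'"] by (simp add: fsubst_uminus)

lemma fsubst_closed:
  assumes "\<And>x. x \<in> bwm_letters m \<Longrightarrow> \<phi> x \<in> carrier (free_alg n)" "p \<in> carrier (free_alg m)"
  shows "fsubst \<phi> p \<in> carrier (free_alg n)"
proof -
  have *: "prod_list (map \<phi> xs) \<in> carrier (free_alg n)" if "set xs \<subseteq> bwm_letters m" for xs
    using that by (induction xs) (auto intro: carrier_free_alg_closed assms(1))
  have sum: "sum f K \<in> carrier (free_alg n)"
    if "\<And>w. w \<in> K \<Longrightarrow> f w \<in> carrier (free_alg n)" for f :: "bwm_word \<Rightarrow> bwm_poly" and K
    using that by (induction K rule: infinite_finite_induct) (auto intro: carrier_free_alg_closed)
  show ?thesis
    unfolding fsubst_def using assms(2)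
    by (intro sum carrier_free_alg_closed const_in_free_alg *) (auto simp: free_alg_def)
qed

lemma fsubst_id: "fsubst fletter p = p"
proof (induction p rule: poly_mapping_sum_induct)
  case (single k v)
  have "prod_list (map fletter xs) = Poly_Mapping.single (Word xs) 1" for xs
    by (induction xs) (auto simp: fletter_def mult_single plus_bwm_word_def simp flip: zero_bwm_word_def)
  then show ?case by (simp add: fsubst_single fconst_def mult_single)
qed (simp add: fsubst_add)

lemma fsubst_ring_hom:
  assumes "\<And>x. x \<in> bwm_letters m \<Longrightarrow> \<phi> x \<in> carrier (free_alg n)"
  shows "fsubst \<phi> \<in> ring_hom (free_alg m) (free_alg n)"
  by (rule ring_hom_memI) (auto simp: free_alg_simps fsubst_add fsubst_mult fsubst_closed[OF assms])

lemma fsubst_ideal: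
  assumes "\<And>x. x \<in> bwm_letters m \<Longrightarrow> \<phi> x \<in> carrier (free_alg n)"
    and "fsubst \<phi> ` bwm_relators r' q' m \<subseteq> bwm_ideal r q n"
  shows "fsubst \<phi> ` bwm_ideal r' q' m \<subseteq> bwm_ideal r q n"
proof -
  interpret R: ring "free_alg m" by (rule ring_free_alg)
  interpret S: ring "free_alg n" by (rule ring_free_alg)
  interpret J: ideal "bwm_ideal r q n" "free_alg n" by (rule ideal_bwm_ideal)
  interpret h: ring_hom_ring "free_alg m" "free_alg n" "fsubst \<phi>"
    using fsubst_ring_hom[OF assms(1)] by (intro ring_hom_ringI2 R.ring_axioms S.ring_axioms)
  have "ideal {p \<in> carrier (free_alg m). fsubst \<phi> p \<in> bwm_ideal r q n} (free_alg m)"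
    by (rule h.ideal_vimage) (rule J.ideal_axioms)
  then have "bwm_ideal r' q' m \<subseteq> {p \<in> carrier (free_alg m). fsubst \<phi> p \<in> bwm_ideal r q n}"
    unfolding bwm_ideal_def[of r' q' m] using assms(2) bwm_relators_subset[of r' q' m]
    by (intro R.genideal_minimal) blast+
  then show ?thesis by auto
qed

lemma bwm_hom_class:
  assumes "\<And>x. x \<in> bwm_letters m \<Longrightarrow> \<phi> x \<in> carrier (free_alg n)"
    and "fsubst \<phi> ` bwm_relators r' q' m \<subseteq> bwm_ideal r q n"
    and "p \<in> carrier (free_alg m)"
  shows "bwm_hom r q n \<phi> (bwm_class r' q' m p) = bwm_class r q n (fsubst \<phi> p)"
proof -
  interpret I: ideal "bwm_ideal r' q' m" "free_alg m" by (rule ideal_bwm_ideal)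
  interpret J: ideal "bwm_ideal r q n" "free_alg n" by (rule ideal_bwm_ideal)
  have 0: "0 \<in> bwm_ideal r' q' m" using additive_subgroup.zero_closed[OF I.is_additive_subgroup] by (simp add: free_alg_simps)
  have J: "a + b \<in> bwm_ideal r q n" if "a \<in> bwm_ideal r q n" "b \<in> bwm_ideal r q n" for a b
    using additive_subgroup.a_closed[OF J.is_additive_subgroup that] by (simp add: free_alg_simps)
  have I: "fsubst \<phi> x \<in> bwm_ideal r q n" if "x \<in> bwm_ideal r' q' m" for x
    using fsubst_ideal[OF assms(1,2)] that by blast
  show ?thesis
  proof (intro Set.set_eqI iffI)
    fix y assume "y \<in> bwm_hom r q n \<phi> (bwm_class r' q' m p)"
    then obtain a x where "a \<in> bwm_ideal r q n" "x \<in> bwm_ideal r' q' m" "y = a + fsubst \<phi> (x + p)"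
      by (auto simp: bwm_hom_def bwm_class_def set_add_def' a_r_coset_def' free_alg_simps)
    then have "y = (a + fsubst \<phi> x) + fsubst \<phi> p" "a + fsubst \<phi> x \<in> bwm_ideal r q n"
      by (auto simp: fsubst_add algebra_simps intro: I J)
    then show "y \<in> bwm_class r q n (fsubst \<phi> p)"
      by (auto simp: bwm_class_def a_r_coset_def' free_alg_simps)
  next
    fix y assume "y \<in> bwm_class r q n (fsubst \<phi> p)"
    then obtain a where "a \<in> bwm_ideal r q n" "y = a + fsubst \<phi> (0 + p)"
      by (auto simp: bwm_class_def a_r_coset_def' free_alg_simps)
    then show "y \<in> bwm_hom r q n \<phi> (bwm_class r' q' m p)"
      using 0 unfolding bwm_hom_def bwm_class_def set_add_def' a_r_coset_def' free_alg_simps by blast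
  qed
qed

lemma carrier_BWM: "carrier (BWM r q n) = bwm_class r q n ` carrier (free_alg n)"
  by (auto simp: BWM_def FactRing_def A_RCOSETS_def' bwm_class_def)

lemma bwm_class_ring_hom: "bwm_class r q n \<in> ring_hom (free_alg n) (BWM r q n)"
  using ideal.rcos_ring_hom[OF ideal_bwm_ideal[of r q n]] by (simp add: BWM_def bwm_class_def[abs_def])

lemma bwm_hom_ring_hom:
  assumes "\<And>x. x \<in> bwm_letters m \<Longrightarrow> \<phi> x \<in> carrier (free_alg n)"
    and "fsubst \<phi> ` bwm_relators r' q' m \<subseteq> bwm_ideal r q n"
  shows "bwm_hom r q n \<phi> \<in> ring_hom (BWM r' q' m) (BWM r q n)"
proof -
  note hc = bwm_hom_class[OF assms]
  note c = fsubst_closed[OF assms(1)]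
  note f = fsubst_ring_hom[OF assms(1)]
  interpret R: ring "free_alg m" by (rule ring_free_alg)
  note h1 = bwm_class_ring_hom[of r' q' m] and h2 = bwm_class_ring_hom[of r q n]
  show ?thesis
  proof (rule ring_hom_memI)
    fix X Y assume "X \<in> carrier (BWM r' q' m)" "Y \<in> carrier (BWM r' q' m)"
    then obtain x y where xy: "x \<in> carrier (free_alg m)" "y \<in> carrier (free_alg m)"
      "X = bwm_class r' q' m x" "Y = bwm_class r' q' m y" by (auto simp: carrier_BWM)
    show "bwm_hom r q n \<phi> (X \<otimes>\<^bsub>BWM r' q' m\<^esub> Y) = bwm_hom r q n \<phi> X \<otimes>\<^bsub>BWM r q n\<^esub> bwm_hom r q n \<phi> Y"
      using xy by (simp add: ring_hom_mult[OF h1, symmetric] ring_hom_mult[OF h2, symmetric] hc c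
          ring_hom_mult[OF f])
    show "bwm_hom r q n \<phi> (X \<oplus>\<^bsub>BWM r' q' m\<^esub> Y) = bwm_hom r q n \<phi> X \<oplus>\<^bsub>BWM r q n\<^esub> bwm_hom r q n \<phi> Y"
      using xy by (simp add: ring_hom_add[OF h1, symmetric] ring_hom_add[OF h2, symmetric] hc c
          ring_hom_add[OF f])
  next
    show "bwm_hom r q n \<phi> \<one>\<^bsub>BWM r' q' m\<^esub> = \<one>\<^bsub>BWM r q n\<^esub>"
      by (simp add: ring_hom_one[OF h1, symmetric] ring_hom_one[OF h2, symmetric] hc ring_hom_one[OF f])
  next
    fix X assume "X \<in> carrier (BWM r' q' m)"
    then show "bwm_hom r q n \<phi> X \<in> carrier (BWM r q n)"
      by (auto simp: carrier_BWM hc c)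
  qed
qed

lemma bwm_relators_in_ideal: "bwm_relators r q n \<subseteq> bwm_ideal r q n"
  unfolding bwm_ideal_def by (rule ring.genideal_self[OF ring_free_alg bwm_relators_subset])

lemma bwm_letters_mono: "m \<le> n \<Longrightarrow> bwm_letters m \<subseteq> bwm_letters n"
  by (auto simp: bwm_letters_def)

lemma bwm_relators_mono: "m \<le> n \<Longrightarrow> bwm_relators r q m \<subseteq> bwm_relators r q n"
  unfolding bwm_relators_def by (intro Un_mono Collect_mono) fastforce+

lemma bwm_embed_ring_hom: "m \<le> n \<Longrightarrow> bwm_embed r q n \<in> ring_hom (BWM r q m) (BWM r q n)"
  and bwm_embed_class: "m \<le> n \<Longrightarrow> p \<in> carrier (free_alg m) \<Longrightarrow>
    bwm_embed r q n (bwm_class r q m p) = bwm_class r q n p"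
proof -
  assume mn: "m \<le> n"
  have 1: "fletter x \<in> carrier (free_alg n)" if "x \<in> bwm_letters m" for x
    using that bwm_letters_mono[OF mn] by (auto intro: letter_in_free_alg)
  have 2: "fsubst fletter ` bwm_relators r q m \<subseteq> bwm_ideal r q n"
    using bwm_relators_mono[OF mn, of r q] bwm_relators_in_ideal[of r q n] by (auto simp: fsubst_id)
  show "bwm_embed r q n \<in> ring_hom (BWM r q m) (BWM r q n)"
    unfolding bwm_embed_def using 1 2 by (rule bwm_hom_ring_hom)
  show "bwm_embed r q n (bwm_class r q m p) = bwm_class r q n p" if "p \<in> carrier (free_alg m)"
    unfolding bwm_embed_def using bwm_hom_class[OF 1 2 that] by (simp add: fsubst_id)
qed

lemma shift_relators:
  "fsubst (\<lambda>x. fletter (shift_letter x)) ` bwm_relators r q m \<subseteq> bwm_relators r q (Suc m)"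
proof -
  have E: "\<exists>i' j'. fg (Suc i) * fg (Suc j) - fg (Suc j) * fg (Suc i) = fg i' * fg j' - fg j' * fg i' \<and>
      Suc 0 \<le> i' \<and> i' < Suc m \<and> Suc 0 \<le> j' \<and> j' < Suc m \<and> (Suc i' < j' \<or> Suc j' < i')"
    if "i < m" "j < m" "Suc i < j \<or> Suc j < i" for i j
    using that by (intro exI[of _ "Suc i"] exI[of _ "Suc j"]) simp
  show ?thesis
    unfolding bwm_relators_def image_Un
    by (intro Un_mono; clarsimp simp: fsubst_diff fsubst_mult fsubst_add power2_eq_square; use E in fastforce)
qed

lemma bwm_shift_ring_hom: "bwm_shift r q (Suc m) \<in> ring_hom (BWM r q m) (BWM r q (Suc m))"
  and bwm_shift_class: "p \<in> carrier (free_alg m) \<Longrightarrow>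
    bwm_shift r q (Suc m) (bwm_class r q m p) =
      bwm_class r q (Suc m) (fsubst (\<lambda>x. fletter (shift_letter x)) p)"
proof -
  have 1: "fletter (shift_letter x) \<in> carrier (free_alg (Suc m))" if "x \<in> bwm_letters m" for x
    using that by (intro letter_in_free_alg) (auto simp: bwm_letters_def)
  have 2: "fsubst (\<lambda>x. fletter (shift_letter x)) ` bwm_relators r q m \<subseteq> bwm_ideal r q (Suc m)"
    using shift_relators bwm_relators_in_ideal by blast
  show "bwm_shift r q (Suc m) \<in> ring_hom (BWM r q m) (BWM r q (Suc m))"
    unfolding bwm_shift_def using 1 2 by (rule bwm_hom_ring_hom)
  show "p \<in> carrier (free_alg m) \<Longrightarrow> bwm_shift r q (Suc m) (bwm_class r q m p) =
      bwm_class r q (Suc m) (fsubst (\<lambda>x. fletter (shift_letter x)) p)"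
    unfolding bwm_shift_def using 1 2 by (rule bwm_hom_class)
qed

lemma bwm_ideal_neg_inverse: "bwm_ideal r (- inverse q) n = bwm_ideal r q n"
  by (simp add: bwm_ideal_def bwm_relators_def qhat_def)

lemma BWM_neg_inverse: "BWM r (- inverse q) n = BWM r q n"
  by (simp add: BWM_def bwm_ideal_neg_inverse)

lemma bwm_gamma_class: "p \<in> carrier (free_alg n) \<Longrightarrow>
    bwm_gamma r q n (bwm_class r (- inverse q) n p) = bwm_class r q n p"
  using bwm_embed_class[of n n p r q]
  by (simp add: bwm_gamma_def bwm_embed_def bwm_class_def bwm_ideal_neg_inverse)

lemma bwm_gamma_ring_iso: "bwm_gamma r q n \<in> ring_iso (BWM r (- inverse q) n) (BWM r q n)"
proof -
  have id: "bwm_gamma r q n X = X" if "X \<in> carrier (BWM r q n)" for X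
    using that bwm_gamma_class by (fastforce simp: carrier_BWM bwm_class_def bwm_ideal_neg_inverse)
  have "bwm_gamma r q n \<in> ring_hom (BWM r q n) (BWM r q n)"
    using bwm_embed_ring_hom[of n n r q] by (simp add: bwm_gamma_def bwm_embed_def)
  moreover have "bij_betw (bwm_gamma r q n) (carrier (BWM r q n)) (carrier (BWM r q n))"
    using bij_betw_id by (subst bij_betw_cong[of _ _ id]) (simp_all add: id)
  ultimately show ?thesis by (simp add: ring_iso_def BWM_neg_inverse)
qed

lemma bwm_embed_gens:
  assumes "m \<le> n" "1 \<le> i" "i < m"
  shows "bwm_embed r q n (bwm_g r q m i) = bwm_g r q n i" "bwm_embed r q n (bwm_e r q m i) = bwm_e r q n i"
  using assms by (auto simp: bwm_g_def bwm_e_def bwm_letters_def intro!: bwm_embed_class letter_in_free_alg)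

lemma bwm_shift_gens:
  assumes "1 \<le> i" "i < m"
  shows "bwm_shift r q (Suc m) (bwm_g r q m i) = bwm_g r q (Suc m) (i + 1)"
    "bwm_shift r q (Suc m) (bwm_e r q m i) = bwm_e r q (Suc m) (i + 1)"
  using assms by (auto simp: bwm_g_def bwm_e_def bwm_letters_def bwm_shift_class letter_in_free_alg)

lemma bwm_gamma_gens:
  assumes "1 \<le> i" "i < n"
  shows "bwm_gamma r q n (bwm_g r (- inverse q) n i) = bwm_g r q n i"
    "bwm_gamma r q n (bwm_e r (- inverse q) n i) = bwm_e r q n i"
  using assms by (auto simp: bwm_g_def bwm_e_def bwm_letters_def intro!: bwm_gamma_class letter_in_free_alg)



section \<open>The elements occurring in the recursion\<close>

text \<open>
  Ordered products of generators along a list of indices. Ascending products run over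
  \<open>[a..<b]\<close>, that is \<open>a, \<dots>, b - 1\<close>, descending ones over \<open>rev [a..<b]\<close>.
\<close>

definition gprod :: "complex \<Rightarrow> complex \<Rightarrow> nat \<Rightarrow> nat list \<Rightarrow> bwm_poly set" where
  "gprod r q n is = foldr (\<lambda>i x. bwm_g r q n i \<otimes>\<^bsub>BWM r q n\<^esub> x) is \<one>\<^bsub>BWM r q n\<^esub>"

definition eprod :: "complex \<Rightarrow> complex \<Rightarrow> nat \<Rightarrow> nat list \<Rightarrow> bwm_poly set" where
  "eprod r q n is = foldr (\<lambda>i x. bwm_e r q n i \<otimes>\<^bsub>BWM r q n\<^esub> x) is \<one>\<^bsub>BWM r q n\<^esub>"

text \<open>
  All elements below are formed in \<open>BWM r q n\<close>; \<open>k\<close> and \<open>i\<close> are the two lower indices.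
\<close>

definition d_minus :: "complex \<Rightarrow> complex \<Rightarrow> nat \<Rightarrow> nat \<Rightarrow> nat \<Rightarrow> bwm_poly set" where
  "d_minus r q n k i =
     eprod r q n (rev [i..<k]) \<otimes>\<^bsub>BWM r q n\<^esub>
     (\<Oplus>\<^bsub>BWM r q n\<^esub>j\<in>{0..i-1}. bwm_smult r q n ((- q) powi (- int j)) (gprod r q n (rev [i-j..<i])))"

definition d_minus' :: "complex \<Rightarrow> complex \<Rightarrow> nat \<Rightarrow> nat \<Rightarrow> nat \<Rightarrow> bwm_poly set" where
  "d_minus' r q n k i =
     eprod r q n [1..<k-i+1] \<otimes>\<^bsub>BWM r q n\<^esub>
     (\<Oplus>\<^bsub>BWM r q n\<^esub>j\<in>{0..i-1}. bwm_smult r q n ((- q) powi (- int j)) (gprod r q n [k+1-i..<k-i+j+1]))"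

definition dbar_minus :: "complex \<Rightarrow> complex \<Rightarrow> nat \<Rightarrow> nat \<Rightarrow> nat \<Rightarrow> bwm_poly set" where
  "dbar_minus r q n k i =
     (\<Oplus>\<^bsub>BWM r q n\<^esub>j\<in>{0..i-1}. bwm_smult r q n ((- q) powi (- int j)) (gprod r q n [i-j..<i]))
     \<otimes>\<^bsub>BWM r q n\<^esub> eprod r q n [i..<k]"

definition dbar_minus' :: "complex \<Rightarrow> complex \<Rightarrow> nat \<Rightarrow> nat \<Rightarrow> nat \<Rightarrow> bwm_poly set" where
  "dbar_minus' r q n k i =
     (\<Oplus>\<^bsub>BWM r q n\<^esub>j\<in>{0..i-1}. bwm_smult r q n ((- q) powi (- int j)) (gprod r q n (rev [k+1-i..<k-i+j+1])))
     \<otimes>\<^bsub>BWM r q n\<^esub> eprod r q n (rev [1..<k-i+1])"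

definition ab_coeff :: "complex \<Rightarrow> complex \<Rightarrow> nat \<Rightarrow> complex" where
  "ab_coeff r q k = qhat q / (1 + q powi (- 2 * int k + 1) * r)"

definition b_minus_k1 :: "complex \<Rightarrow> complex \<Rightarrow> nat \<Rightarrow> nat \<Rightarrow> bwm_poly set" where
  "b_minus_k1 r q n k =
     (\<Oplus>\<^bsub>BWM r q n\<^esub>i\<in>{0..k}. bwm_smult r q n ((- q) powi (- int i)) (gprod r q n (rev [k+1-i..<k+1])))
     \<ominus>\<^bsub>BWM r q n\<^esub> bwm_smult r q n (ab_coeff r q k)
       (\<Oplus>\<^bsub>BWM r q n\<^esub>i\<in>{1..k}. bwm_smult r q n (q powi (2 * int i - 2 * int k - 1)) (d_minus r q n (k+1) i))"

definition b_minus_1k :: "complex \<Rightarrow> complex \<Rightarrow> nat \<Rightarrow> nat \<Rightarrow> bwm_poly set" where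
  "b_minus_1k r q n k =
     (\<Oplus>\<^bsub>BWM r q n\<^esub>i\<in>{0..k}. bwm_smult r q n ((- q) powi (- int i)) (gprod r q n [1..<i+1]))
     \<ominus>\<^bsub>BWM r q n\<^esub> bwm_smult r q n (ab_coeff r q k)
       (\<Oplus>\<^bsub>BWM r q n\<^esub>i\<in>{1..k}. bwm_smult r q n (q powi (2 * int i - 2 * int k - 1)) (d_minus' r q n (k+1) i))"

definition a_minus_k1 :: "complex \<Rightarrow> complex \<Rightarrow> nat \<Rightarrow> nat \<Rightarrow> bwm_poly set" where
  "a_minus_k1 r q n k =
     (\<Oplus>\<^bsub>BWM r q n\<^esub>i\<in>{0..k}. bwm_smult r q n ((- q) powi (- int i)) (gprod r q n [k+1-i..<k+1]))
     \<ominus>\<^bsub>BWM r q n\<^esub> bwm_smult r q n (ab_coeff r q k)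
       (\<Oplus>\<^bsub>BWM r q n\<^esub>i\<in>{1..k}. bwm_smult r q n (q powi (2 * int i - 2 * int k - 1)) (dbar_minus r q n (k+1) i))"

definition a_minus_1k :: "complex \<Rightarrow> complex \<Rightarrow> nat \<Rightarrow> nat \<Rightarrow> bwm_poly set" where
  "a_minus_1k r q n k =
     (\<Oplus>\<^bsub>BWM r q n\<^esub>i\<in>{0..k}. bwm_smult r q n ((- q) powi (- int i)) (gprod r q n (rev [1..<i+1])))
     \<ominus>\<^bsub>BWM r q n\<^esub> bwm_smult r q n (ab_coeff r q k)
       (\<Oplus>\<^bsub>BWM r q n\<^esub>i\<in>{1..k}. bwm_smult r q n (q powi (2 * int i - 2 * int k - 1)) (dbar_minus' r q n (k+1) i))"

end

theory Submission
  imports Defs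
begin

text \<open>
  Write \<open>p = - 1 / q\<close> and say that \<open>a\<close> absorbs \<open>g\<^sub>i\<close> if \<open>a g\<^sub>i = p a\<close>. By the quadratic
  relation such an \<open>a\<close> also satisfies \<open>a e\<^sub>i = 0\<close>.

  The heart of the matter is that multiplication by \<open>b\<^sup>-\<^sub>k\<^sub>,\<^sub>1\<close> propagates absorption: if \<open>a\<close> absorbs
  \<open>g\<^sub>1, \<dots>, g\<^sub>k\<^sub>-\<^sub>1\<close>, then \<open>a b\<^sup>-\<^sub>k\<^sub>,\<^sub>1\<close> absorbs \<open>g\<^sub>1, \<dots>, g\<^sub>k\<close>
  (\<open>recursion_factor_absorbs\<close>). The first sum \<open>X\<^sub>k\<close> of \<open>b\<^sup>-\<^sub>k\<^sub>,\<^sub>1\<close> is the Hecke algebra answer, and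
  there it would suffice. Here \<open>a X\<^sub>k (g\<^sub>m - p)\<close> is a multiple of
  \<open>v\<^sub>m = a e\<^sub>k \<dots> e\<^sub>m\<close>, with a coefficient that is independent of \<open>m\<close> (\<open>absorb_X_g\<close>). The summands of the second sum are
  \<open>e\<^sub>k \<dots> e\<^sub>i X\<^sub>i\<^sub>-\<^sub>1\<close>, so that the same lemma controls them too, and with the coefficients
  \<open>q\<^sup>2\<^sup>i\<^sup>-\<^sup>2\<^sup>k\<^sup>-\<^sup>1\<close> their contributions collapse to another multiple of \<open>v\<^sub>m\<close>
  (\<open>correction_sum_g\<close>). The prefactor of the second sum makes the two multiples cancel.

  Starting from 1, the recursion therefore builds an element that absorbs all generators on the
  right. The character \<open>g\<^sub>i \<mapsto> p\<close>, \<open>e\<^sub>i \<mapsto> 0\<close> takes the value 1 on it; this is where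
  \<open>q\<^sup>n\<^sup>-\<^sup>1\<close> and the quantum integer come from. An absorbing element multiplies every other element
  through this character, so it is idempotent and not zero. The relations are invariant under
  reversal of words, so there is also an element that absorbs on the left, and the product of the
  two, evaluated from both sides, shows that they coincide. The same argument gives
  uniqueness: every element on which the character is 1 and which absorbs all generators on
  either side is the antisymmetrizer (\<open>antisymmetrizer_characterization\<close>).

  The four formulas are then instances of one: the flip \<open>i \<mapsto> n - i\<close> exchanges \<open>b\<^sup>-\<^sub>k\<^sub>,\<^sub>1\<close> with
  \<open>b\<^sup>-\<^sub>1\<^sub>,\<^sub>k\<close>, reversal exchanges \<open>b\<close> with \<open>a\<close>, and the shifted \<open>A\<^sub>n\<^sub>-\<^sub>1\<close> absorbs
  \<open>g\<^sub>2, \<dots>, g\<^sub>n\<^sub>-\<^sub>1\<close>, which are the first \<open>n - 2\<close> flipped generators.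
\<close>

section \<open>Representations of the Birman--Wenzl--Murakami relations\<close>

locale complex_algebra = module scale
  for scale :: "complex \<Rightarrow> 'a::ring_1 \<Rightarrow> 'a" (infixr "\<cdot>" 75) +
  assumes mult_scale_left [simp]: "c \<cdot> x * y = c \<cdot> (x * y)"
    and mult_scale_right [simp]: "x * c \<cdot> y = c \<cdot> (x * y)"

text \<open>
  All computations take place in an arbitrary complex algebra with elements that satisfy the
  relations. The same lemmas then serve for four sequences of generators: the given ones, the
  flipped ones \<open>g (n - i)\<close>, and both of these in the opposite algebra. The shifted sequence
  \<open>g (i + 1)\<close> is a fifth instance.
\<close>
locale bwm_rep = complex_algebra scale
  for scale :: "complex \<Rightarrow> 'a::ring_1 \<Rightarrow> 'a" (infixr "\<cdot>" 75) +
  fixes g e :: "nat \<Rightarrow> 'a" and r q :: complex and n :: nat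
  assumes params: "bwm_params r q"
    and braid: "1 \<le> i \<Longrightarrow> i + 1 < n \<Longrightarrow> g i * (g (i+1) * g i) = g (i+1) * (g i * g (i+1))"
    and gg_commute: "1 \<le> i \<Longrightarrow> i + 1 < j \<Longrightarrow> j < n \<Longrightarrow> g i * g j = g j * g i"
    and g_square: "1 \<le> i \<Longrightarrow> i < n \<Longrightarrow> g i * g i = 1 + qhat q \<cdot> g i - (inverse r * qhat q) \<cdot> e i"
    and ge: "1 \<le> i \<Longrightarrow> i < n \<Longrightarrow> g i * e i = inverse r \<cdot> e i"
    and eg: "1 \<le> i \<Longrightarrow> i < n \<Longrightarrow> e i * g i = inverse r \<cdot> e i"
    and gge_up: "1 \<le> i \<Longrightarrow> i + 1 < n \<Longrightarrow> g i * (g (i+1) * e i) = e (i+1) * e i"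
    and gge_down: "1 \<le> i \<Longrightarrow> i + 1 < n \<Longrightarrow> g (i+1) * (g i * e (i+1)) = e i * e (i+1)"
begin

definition p :: complex where "p = - inverse q"

lemma q0: "q \<noteq> 0" and r0: "r \<noteq> 0" and qhat0: "qhat q \<noteq> 0"
proof -
  show 1: "q \<noteq> 0" "r \<noteq> 0" using params by (auto simp: bwm_params_def)
  have "q ^ 2 \<noteq> 1" using params unfolding bwm_params_def by (metis zero_less_numeral)
  then show "qhat q \<noteq> 0" using 1
    by (auto simp: qhat_def field_simps power2_eq_square)
qed

lemma p_quadratic: "p * p = 1 + qhat q * p"
  using q0 by (simp add: p_def qhat_def field_simps)

lemma p0: "p \<noteq> 0"
  using q0 by (simp add: p_def)

lemma e_as_poly: "1 \<le> i \<Longrightarrow> i < n \<Longrightarrow> (inverse r * qhat q) \<cdot> e i = 1 + qhat q \<cdot> g i - g i * g i"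
  using g_square[of i] by simp

lemma scale_cancel:
  assumes "c \<cdot> x = c \<cdot> y" "c \<noteq> 0" shows "x = y"
proof -
  have "inverse c \<cdot> (c \<cdot> x) = inverse c \<cdot> (c \<cdot> y)" by (simp only: assms)
  then show ?thesis using assms(2) by simp
qed

text \<open>
  Since \<open>e i\<close> is a polynomial in \<open>g i\<close>, whatever intertwines \<open>g i\<close> with \<open>g j\<close>
  also intertwines \<open>e i\<close> with \<open>e j\<close>.
\<close>
lemma intertwine_e:
  assumes y: "y * g i = g j * y" and "1 \<le> i" "i < n" "1 \<le> j" "j < n"
  shows "y * e i = e j * y"
proof (rule scale_cancel)
  have "y * (g i * g i) = g j * g j * y" by (metis y mult.assoc)
  then have "y * (1 + qhat q \<cdot> g i - g i * g i) = (1 + qhat q \<cdot> g j - g j * g j) * y"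
    by (simp add: distrib_left distrib_right left_diff_distrib right_diff_distrib y)
  then show "(inverse r * qhat q) \<cdot> (y * e i) = (inverse r * qhat q) \<cdot> (e j * y)"
    using assms by (metis e_as_poly mult_scale_left mult_scale_right)
qed (use r0 qhat0 in simp)

lemma gg_far: "1 \<le> i \<Longrightarrow> i < n \<Longrightarrow> 1 \<le> j \<Longrightarrow> j < n \<Longrightarrow> i + 1 < j \<or> j + 1 < i \<Longrightarrow> g i * g j = g j * g i"
  using gg_commute[of i j] gg_commute[of j i] by auto

lemma ge_far: "1 \<le> i \<Longrightarrow> i < n \<Longrightarrow> 1 \<le> j \<Longrightarrow> j < n \<Longrightarrow> i + 1 < j \<or> j + 1 < i \<Longrightarrow> g i * e j = e j * g i"
  using gg_far[of i j] intertwine_e[of "g i" j j] by simp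

text \<open>
  The relations list only \<open>g i * g (i+1) * e i\<close> and its mirror image under \<open>i \<leftrightarrow> i + 1\<close>.
  The reversed words come from conjugation: by the braid relation \<open>g i * g (i+1)\<close>
  intertwines \<open>g i\<close> with \<open>g (i+1)\<close>, hence \<open>e i\<close> with \<open>e (i+1)\<close>.
\<close>
lemma e_gg_up:
  assumes "1 \<le> i" "i + 1 < n" shows "e (i+1) * (g i * g (i+1)) = e (i+1) * e i"
proof -
  have "g i * g (i+1) * e i = e (i+1) * (g i * g (i+1))"
    using braid[OF assms] assms by (intro intertwine_e) (auto simp: mult.assoc)
  then show ?thesis using gge_up[OF assms] by (simp add: mult.assoc)
qed

lemma e_gg_down:
  assumes "1 \<le> i" "i + 1 < n" shows "e i * (g (i+1) * g i) = e i * e (i+1)"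
proof -
  have "g (i+1) * g i * e (i+1) = e i * (g (i+1) * g i)"
    using braid[OF assms] assms by (intro intertwine_e) (auto simp: mult.assoc)
  then show ?thesis using gge_down[OF assms] by (simp add: mult.assoc)
qed

definition ginv :: "nat \<Rightarrow> 'a" where "ginv i = g i - qhat q \<cdot> 1 + qhat q \<cdot> e i"

lemma ginv:
  assumes "1 \<le> i" "i < n" shows "g i * ginv i = 1" "ginv i * g i = 1"
  using g_square[OF assms] ge[OF assms] eg[OF assms]
  by (simp_all add: ginv_def algebra_simps)

lemma absorb_ginv:
  assumes "a * g i = p \<cdot> a" "1 \<le> i" "i < n" shows "a * ginv i = inverse p \<cdot> a"
proof -
  have "p \<cdot> (a * ginv i) = a" using assms ginv(1)[OF assms(2,3)]
    by (metis mult.assoc mult.right_neutral mult_scale_left)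
  then have "inverse p \<cdot> (p \<cdot> (a * ginv i)) = inverse p \<cdot> a" by simp
  then show ?thesis using p0 by simp
qed

text \<open>
  On a vector where \<open>g i\<close> acts by \<open>p\<close>, a root of \<open>p\<^sup>2 = 1 + qhat q * p\<close>, the quadratic
  relation leaves no room for \<open>e i\<close>.
\<close>
lemma absorb_e:
  assumes "a * g i = p \<cdot> a" "1 \<le> i" "i < n" shows "a * e i = 0"
proof -
  have "(inverse r * qhat q) \<cdot> (a * e i) = a * (1 + qhat q \<cdot> g i - g i * g i)"
    by (simp flip: e_as_poly[OF assms(2,3)])
  also have "\<dots> = a + (qhat q * p) \<cdot> a - (p * p) \<cdot> a"
    by (simp add: distrib_left right_diff_distrib assms flip: mult.assoc)
  also have "\<dots> = 0"
    unfolding p_quadratic by (simp add: scale_left_distrib scale_left_diff_distrib)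
  finally show ?thesis using r0 qhat0 by (auto intro: scale_cancel)
qed

text \<open>
  The familiar identity \<open>e (i+1) * e i * e (i+1) = e (i+1)\<close> does not follow from the relations for
  all admissible parameters: if \<open>r = - qhat q\<close>, then \<open>g i \<mapsto> 1 / r\<close>, \<open>e i \<mapsto> 1 / r\<^sup>2\<close> is a
  one-dimensional representation that violates it. What does follow is that \<open>1 + qhat q \<cdot> g i\<close>
  annihilates the difference of the two sides from the left. To the right of an element that
  absorbs \<open>g i\<close> this factor is the nonzero scalar \<open>1 + qhat q * p = p\<^sup>2\<close>, so there the
  identity holds.
\<close>
lemma absorb_e_sandwich:
  assumes a: "a * g i = p \<cdot> a" and i: "1 \<le> i" "i + 1 < n"
  shows "a * (e (i+1) * (e i * e (i+1))) = a * e (i+1)"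
proof -
  let ?Q = "qhat q" and ?R = "inverse r"
  have i': "i < n" "1 \<le> i + 1" using i by auto
  define z where "z = e (i+1) * (e i * e (i+1))"
  have z: "z = ?R \<cdot> (e (i+1) * (g i * e (i+1)))"
  proof -
    have "z = e (i+1) * g (i+1) * (g i * e (i+1))"
      unfolding z_def gge_down[OF i, symmetric] by (simp add: mult.assoc)
    then show ?thesis using eg[OF i'(2) i(2)] by (metis mult.assoc mult_scale_left)
  qed
  have "z = g i * (g (i+1) * (e i * e (i+1)))"
    using gge_up[OF i] by (simp add: z_def flip: mult.assoc)
  also have "e i * e (i+1) = g (i+1) * (g i * e (i+1))" using gge_down[OF i] by simp
  also have "g i * (g (i+1) * (g (i+1) * (g i * e (i+1)))) = g i * (g (i+1) * g (i+1)) * (g i * e (i+1))"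
    by (simp add: mult.assoc)
  also have "\<dots> = g i * g i * e (i+1) + ?Q \<cdot> (g i * (g (i+1) * g i) * e (i+1))
      - (?R * ?Q) \<cdot> (g i * (e (i+1) * (g i * e (i+1))))"
    unfolding g_square[OF i'(2) i(2)]
    by (simp add: distrib_left distrib_right left_diff_distrib right_diff_distrib mult.assoc)
  also have "g i * (g (i+1) * g i) * e (i+1) = ?R \<cdot> (e i * e (i+1))"
    unfolding braid[OF i] mult.assoc ge[OF i'(2) i(2)] mult_scale_right gge_down[OF i] ..
  also have "(?R * ?Q) \<cdot> (g i * (e (i+1) * (g i * e (i+1)))) = ?Q \<cdot> (g i * z)"
    unfolding z by (simp add: mult.commute)
  also have "g i * g i * e (i+1) = e (i+1) + ?Q \<cdot> (g i * e (i+1)) - (?R * ?Q) \<cdot> (e i * e (i+1))"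
    unfolding g_square[OF i(1) i'(1)] by (simp add: distrib_right left_diff_distrib)
  finally have "z - e (i+1) = ?Q \<cdot> (g i * (e (i+1) - z))"
    by (simp add: algebra_simps)
  then have "a * (z - e (i+1)) = ?Q \<cdot> (a * g i * (e (i+1) - z))"
    by (simp only: mult_scale_right mult.assoc)
  also have "\<dots> = (- (?Q * p)) \<cdot> (a * (z - e (i+1)))"
    unfolding a mult_scale_left scale_scale
    by (metis (no_types, opaque_lifting) minus_diff_eq mult_minus_right scale_minus_left scale_minus_right)
  finally have "(1 + ?Q * p) \<cdot> (a * (z - e (i+1))) = 0"
    by (simp add: scale_left_distrib eq_neg_iff_add_eq_0)
  then have "(p * p) \<cdot> (a * (z - e (i+1))) = 0" unfolding p_quadratic .
  then have "a * (z - e (i+1)) = 0" using p0 scale_cancel[of "p * p" _ 0] by simp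
  then show ?thesis by (simp add: z_def right_diff_distrib)
qed

end

section \<open>The factor of the recursion\<close>

text \<open>
  \<open>staircase scale g p k\<close> is the sum of the products \<open>p\<^sup>i g\<^sub>k \<dots> g\<^sub>k\<^sub>+\<^sub>1\<^sub>-\<^sub>i\<close>, here in
  Horner form. The same sum, with \<open>k\<close> replaced by \<open>i - 1\<close>, is the right factor of
  \<open>d_minus r q n (k+1) i\<close>; this repetition is what makes the computation manageable.
\<close>
primrec staircase :: "(complex \<Rightarrow> 'a::ring_1 \<Rightarrow> 'a) \<Rightarrow> (nat \<Rightarrow> 'a) \<Rightarrow> complex \<Rightarrow> nat \<Rightarrow> 'a" where
  "staircase scale g p 0 = 1"
| "staircase scale g p (Suc k) = 1 + scale p (g (Suc k) * staircase scale g p k)"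

definition descend :: "(nat \<Rightarrow> 'a::monoid_mult) \<Rightarrow> nat \<Rightarrow> nat \<Rightarrow> 'a" where
  "descend e k i = prod_list (map e (rev [i..<k+1]))"

text \<open>
  This is \<open>b_minus_k1\<close> for arbitrary generators. The other three elements of the recursion arise
  from it by the flip \<open>i \<mapsto> n - i\<close> and by passing to the opposite algebra.
\<close>
definition recursion_factor ::
    "(complex \<Rightarrow> 'a::ring_1 \<Rightarrow> 'a) \<Rightarrow> (nat \<Rightarrow> 'a) \<Rightarrow> (nat \<Rightarrow> 'a) \<Rightarrow> complex \<Rightarrow> complex \<Rightarrow> nat \<Rightarrow> 'a" where
  "recursion_factor scale g e r q k = staircase scale g (- inverse q) k - scale (ab_coeff r q k)
     (\<Sum>i=1..k. scale (q powi (2 * int i - 2 * int k - 1)) (descend e k i * staircase scale g (- inverse q) (i-1)))"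

lemma descend_right: "i \<le> k \<Longrightarrow> descend e k i = descend e k (i+1) * e i"
  by (simp add: descend_def upt_conv_Cons del: upt_Suc)

lemma descend_left: "i \<le> k + 1 \<Longrightarrow> descend e (k+1) i = e (k+1) * descend e k i"
  by (simp add: descend_def)

lemma descend_trivial [simp]: "descend e k (Suc k) = 1" "descend e k k = e k"
  by (simp_all add: descend_def)

lemma descend_split: "i \<le> j \<Longrightarrow> 1 \<le> i \<Longrightarrow> j \<le> k + 1 \<Longrightarrow> descend e k j * (descend e (j-1) i) = descend e k i"
proof (induction j rule: dec_induct)
  case base then show ?case by (cases i) (simp_all add: descend_def)
next
  case (step j)
  have "descend e j i = e j * descend e (j-1) i" if "j > 0"
    using descend_left[of i "j-1" e] step that by simp
  moreover have "descend e k j = descend e k (Suc j) * e j" using descend_right[of j k e] step by simp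
  moreover have "descend e 0 0 = e 0" by simp
  ultimately show ?case using step by (cases "j = 0") (simp_all add: mult.assoc)
qed

context bwm_rep begin

abbreviation "X \<equiv> staircase scale g p"
abbreviation "E \<equiv> descend e"

lemma distribs: "x * (y + z) = x * y + x * (z::'a)" "(x + y) * z = x * z + y * z"
  by (simp_all add: algebra_simps)

lemma X_commute:
  assumes "\<And>j. 1 \<le> j \<Longrightarrow> j \<le> k \<Longrightarrow> g j * x = x * g j" shows "X k * x = x * X k"
  using assms
proof (induction k)
  case (Suc k)
  have "g (Suc k) * X k * x = x * (g (Suc k) * X k)"
    using Suc by (metis (no_types) le_Suc_eq le_add1 mult.assoc plus_1_eq_Suc)
  then show ?case by (simp add: distribs)
qed simp

lemma E_commute:
  assumes "\<And>j. i \<le> j \<Longrightarrow> j \<le> k \<Longrightarrow> e j * x = x * e j" shows "E k i * x = x * E k i"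
proof -
  have "prod_list (map e xs) * x = x * prod_list (map e xs)" if "\<forall>j\<in>set xs. e j * x = x * e j" for xs
    using that by (induction xs) (auto simp: mult.assoc, metis mult.assoc)
  then show ?thesis unfolding descend_def using assms by (auto simp del: upt_Suc)
qed

abbreviation absorbs :: "'a \<Rightarrow> nat \<Rightarrow> bool" where
  "absorbs a k \<equiv> (\<forall>j. 1 \<le> j \<longrightarrow> j < k \<longrightarrow> a * g j = p \<cdot> a)"

lemma absorb_commute:
  assumes "a * g j = p \<cdot> a" "g j * x = x * g j" shows "a * x * g j = p \<cdot> (a * x)"
  using assms by (metis mult.assoc mult_scale_left)

lemma absorb_X:
  "absorbs a (k+1) \<Longrightarrow> a * X k = (\<Sum>j\<le>k. p ^ (2*j)) \<cdot> a"
proof (induction k)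
  case (Suc k)
  then have "a * X k = (\<Sum>j\<le>k. p ^ (2*j)) \<cdot> a" by simp
  moreover have "a * g (Suc k) = p \<cdot> a" using Suc.prems by simp
  moreover have "a * X (Suc k) = a + p \<cdot> (a * g (Suc k) * X k)" by (simp add: distribs mult.assoc)
  ultimately have "a * X (Suc k) = (1 + p * p * (\<Sum>j\<le>k. p ^ (2*j))) \<cdot> a"
    by (simp add: scale_left_distrib mult.assoc)
  also have "1 + p * p * (\<Sum>j\<le>k. p ^ (2*j)) = (\<Sum>j\<le>Suc k. p ^ (2*j))"
    by (subst sum.atMost_Suc_shift) (simp add: sum_distrib_left mult.assoc)
  finally show ?case .
qed simp

lemma g_e_adjacent:
  assumes "1 \<le> i" "i + 1 < n" shows "g (i+1) * e i = ginv i * (e (i+1) * e i)"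
  using gge_up[OF assms] ginv(2)[of i] assms by (metis add_lessD1 mult.assoc mult.left_neutral)

text \<open>
  Multiplying \<open>X k\<close> by \<open>g m\<close>, the braid relation moves \<open>g m\<close> to the left of almost every
  term, where it is absorbed. Only the terms whose word ends in \<open>g (m+1)\<close> or \<open>g m\<close> interact,
  and by the quadratic relation they leave one term with \<open>e m\<close> behind. That term is turned into
  \<open>E k m\<close> because \<open>a * g (i+1) * e i = inverse p \<cdot> a * e (i+1) * e i\<close>
  whenever \<open>a\<close> absorbs \<open>g i\<close>.
\<close>
lemma absorb_X_g:
  assumes "absorbs a k" "1 \<le> m" "m \<le> k" "k < n"
  shows "a * X k * g m = p \<cdot> (a * X k) - (p * inverse r * qhat q) \<cdot> (a * E k m)"
  using assms
proof (induction k arbitrary: a m)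
  case (Suc k)
  let ?Q = "qhat q" and ?R = "inverse r"
  have aX: "a * X (Suc k) = a + p \<cdot> (a * g (Suc k) * X k)"
    by (simp add: distribs mult.assoc)
  show ?case
  proof (cases "m = Suc k")
    case False
    \<comment> \<open>\<open>X (Suc k) = 1 + p \<cdot> (g (Suc k) * X k)\<close>, and \<open>a * g (Suc k)\<close> still absorbs the generators below \<open>k\<close>.\<close>
    have a': "absorbs (a * g (Suc k)) k"
      using Suc.prems by (intro allI impI absorb_commute gg_far) auto
    have IH: "a * g (Suc k) * X k * g m =
        p \<cdot> (a * g (Suc k) * X k) - (p * ?R * ?Q) \<cdot> (a * g (Suc k) * E k m)"
      using Suc.IH[of "a * g (Suc k)" m] a' Suc.prems False by simp
    have "E k m = e k * E (k-1) m" using descend_left[of m "k-1" e] Suc.prems False by simp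
    then have "a * g (Suc k) * E k m = a * (g (k+1) * e k) * E (k-1) m" by (simp add: mult.assoc)
    also have "\<dots> = a * ginv k * (e (k+1) * (e k * E (k-1) m))"
      using Suc.prems False by (subst g_e_adjacent) (auto simp: mult.assoc)
    also have "a * ginv k = inverse p \<cdot> a"
      using Suc.prems False by (intro absorb_ginv) auto
    also have "e (k+1) * (e k * E (k-1) m) = E (Suc k) m"
      using descend_left[of m "k-1" e] descend_left[of m "k" e] Suc.prems False by simp
    finally have v: "p \<cdot> (a * g (Suc k) * E k m) = a * E (Suc k) m" using p0 by simp
    have "a * X (Suc k) * g m = a * g m + p \<cdot> (a * g (Suc k) * X k * g m)"
      unfolding aX by (simp add: distribs mult.assoc)
    also have "\<dots> = p \<cdot> a + p \<cdot> p \<cdot> (a * g (Suc k) * X k) - (p * ?R * ?Q) \<cdot> p \<cdot> (a * g (Suc k) * E k m)"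
      unfolding IH scale_right_diff_distrib using Suc.prems False by (simp add: mult_ac)
    finally show ?thesis unfolding aX v by (simp add: scale_right_distrib)
  next
    case m: True
    have sq: "a * (g (Suc k) * g (Suc k)) = a + ?Q \<cdot> (a * g (Suc k)) - (?R * ?Q) \<cdot> (a * e (Suc k))"
      using g_square[of "Suc k"] \<open>Suc k < n\<close> by (simp add: distribs right_diff_distrib)
    have *: "p \<cdot> (a * (g (Suc k) * (X k * g (Suc k)))) =
        p \<cdot> (a + ?Q \<cdot> (a * g (Suc k)) - (?R * ?Q) \<cdot> (a * e (Suc k))) + (p * p) \<cdot> (a * g (Suc k) * (X k - 1))"
    proof (cases k)
      case 0
      then show ?thesis using sq by simp
    next
      case (Suc l)
      have "X l * g (Suc k) = g (Suc k) * X l"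
        using \<open>Suc k < n\<close> Suc by (intro X_commute gg_far) auto
      then have "X k * g (Suc k) = g (Suc k) + p \<cdot> (g k * (g (Suc k) * X l))"
        using Suc by (simp add: distribs mult.assoc)
      then have "a * (g (Suc k) * (X k * g (Suc k))) =
          a * (g (Suc k) * g (Suc k)) + p \<cdot> (a * (g (Suc k) * (g k * g (Suc k))) * X l)"
        by (simp add: distribs mult.assoc)
      also have "g (Suc k) * (g k * g (Suc k)) = g k * (g (Suc k) * g k)"
        using braid[of k] \<open>Suc k < n\<close> Suc by simp
      also have "a * (g k * (g (Suc k) * g k)) = p \<cdot> (a * (g (Suc k) * g k))"
        using \<open>absorbs a (Suc k)\<close> Suc by (simp flip: mult.assoc)
      also have "p \<cdot> (p \<cdot> (a * (g (Suc k) * g k)) * X l) = p \<cdot> (a * g (Suc k) * (X k - 1))"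
        using Suc by (simp add: mult.assoc)
      also note sq
      finally show ?thesis by (simp add: scale_right_distrib)
    qed
    have "a * X (Suc k) * g m = a * g (Suc k) + p \<cdot> (a * (g (Suc k) * (X k * g (Suc k))))"
      unfolding aX m by (simp add: distribs mult.assoc)
    also have "\<dots> = (1 + ?Q * p) \<cdot> (a * g (Suc k)) + p \<cdot> a - (p * ?R * ?Q) \<cdot> (a * e (Suc k))
        + (p * p) \<cdot> (a * g (Suc k) * X k) - (p * p) \<cdot> (a * g (Suc k))"
      unfolding * by (simp add: algebra_simps)
    also have "\<dots> = p \<cdot> (a * X (Suc k)) - (p * ?R * ?Q) \<cdot> (a * E (Suc k) m)"
      unfolding aX m p_quadratic[symmetric] by (simp add: scale_right_distrib mult_ac)
    finally show ?thesis .
  qed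
qed simp

end

section \<open>The factor of the recursion propagates absorption\<close>

context bwm_rep begin

lemma qhat_p: "qhat q = p - inverse p"
  using q0 by (simp add: qhat_def p_def)

lemma E_g_commute:
  assumes "k < n" "1 \<le> i" "1 \<le> j" "j + 1 < i \<or> (k + 1 < j \<and> j < n)"
  shows "g j * E k i = E k i * g j"
  using assms by (intro E_commute[symmetric] ge_far[symmetric]) auto

lemma absorbs_E:
  assumes "absorbs a k" "k < n" "1 \<le> i" "i \<le> k" shows "absorbs (a * E k i) (i-1)"
  using assms by (intro allI impI absorb_commute E_g_commute) auto

text \<open>
  Without the left factor \<open>a\<close> this is the tangle identity
  \<open>e (i+1) * e i * g (i+1) = e (i+1) * ginv i\<close>, which needs \<open>absorb_e_sandwich\<close>.
\<close>
lemma E_g_adjacent: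
  assumes a: "absorbs a k" and i: "1 \<le> i" "i < k" and k: "k < n"
  shows "a * E k i * g (i+1) = a * E k (i+1) * ginv i"
proof -
  have i': "1 \<le> i" "i + 1 < n" using i k by auto
  define b where "b = a * E k (i+2)"
  have b: "b * g i = p \<cdot> b"
    unfolding b_def using a i k by (intro absorb_commute E_g_commute) auto
  have E: "E k (i+1) = E k (i+2) * e (i+1)" "E k i = E k (i+2) * (e (i+1) * e i)"
    using i descend_right[of i k e] descend_right[of "i+1" k e] by (simp_all add: mult.assoc)
  have "e i * g (i+1) = e i * (g (i+1) * g i) * ginv i"
    using ginv(1)[of i] i' by (simp add: mult.assoc)
  also have "\<dots> = e i * e (i+1) * ginv i" by (simp only: e_gg_down[OF i'])
  finally have "a * E k i * g (i+1) = b * (e (i+1) * (e i * e (i+1))) * ginv i"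
    by (simp add: E b_def mult.assoc)
  also have "\<dots> = b * e (i+1) * ginv i" by (simp only: absorb_e_sandwich[OF b i'])
  also have "\<dots> = a * E k (i+1) * ginv i" by (simp only: E b_def mult.assoc)
  finally show ?thesis .
qed

lemma E_g_inner:
  assumes a: "absorbs a k" and i: "1 \<le> i" "i + 2 \<le> m" "m \<le> k" and k: "k < n"
  shows "a * E k i * g m = p \<cdot> (a * E k i)"
proof -
  obtain l where m: "m = l + 2" using i by (intro that[of "m-2"]) simp
  have l: "1 \<le> l" "i \<le> l" "l + 2 \<le> k" using i m by auto
  define b where "b = a * E k (l+2)"
  have b: "b * g l = p \<cdot> b"
    unfolding b_def using a l k by (intro absorb_commute E_g_commute) auto
  have be: "b * e l = 0" using b l k by (intro absorb_e) auto
  have split: "E k i = E k (l+1) * E l i" "E l i = e l * E (l-1) i" "E k (l+1) = E k (l+2) * e (l+1)"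
    using descend_split[of i "l+1" k e] descend_left[of i "l-1" e] descend_right[of "l+1" k e] i l by auto
  have "a * E k i * g m = a * E k (l+1) * (E l i * g m)" using split by (simp add: mult.assoc)
  also have "E l i * g m = g m * E l i"
    using i k l m by (intro E_g_commute[symmetric]) auto
  also have "a * E k (l+1) * (g m * E l i) = (a * E k (l+1) * g (l+1+1)) * E l i"
    by (simp add: m mult.assoc)
  also have "a * E k (l+1) * g (l+1+1) = b * ginv (l+1)"
    using l a k by (subst E_g_adjacent) (auto simp: b_def)
  also have "b * ginv (l+1) * E l i = (b * (g (l+1) * e l) - qhat q \<cdot> (b * e l) + qhat q \<cdot> (b * (e (l+1) * e l)))
      * E (l-1) i"
    unfolding split(2) ginv_def by (simp add: algebra_simps)
  also have "b * (g (l+1) * e l) = inverse p \<cdot> (b * (e (l+1) * e l))"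
  proof -
    have "b * (g (l+1) * e l) = b * ginv l * (e (l+1) * e l)"
      using l k by (subst g_e_adjacent) (auto simp: mult.assoc)
    then show ?thesis using absorb_ginv[OF b] l k by simp
  qed
  finally have "a * E k i * g m = (inverse p + qhat q) \<cdot> (b * (e (l+1) * (e l * E (l-1) i)))"
    by (simp add: be distribs scale_left_distrib mult.assoc)
  also have "b * (e (l+1) * (e l * E (l-1) i)) = a * E k i"
    by (simp only: b_def split mult.assoc)
  finally show ?thesis by (simp add: qhat_p)
qed

lemma coeff_eq:
  assumes "i \<le> k" shows "q powi (2 * int i - 2 * int k - 1) = - (p ^ (2 * (k-i) + 1))"
proof -
  have "2 * int i - 2 * int k - 1 = - int (2 * (k-i) + 1)" using assms by auto
  then have "q powi (2 * int i - 2 * int k - 1) = inverse q ^ (2 * (k-i) + 1)"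
    by (simp only: power_int_minus power_int_of_nat power_inverse)
  then show ?thesis by (simp add: p_def)
qed

lemma coeff_sum:
  assumes "i \<le> k"
  shows "(1 - p\<^sup>2) * (\<Sum>j=i+1..k. q powi (2 * int j - 2 * int k - 1)) = - p - q powi (2 * int i - 2 * int k - 1)"
  using assms
proof (induction i rule: inc_induct)
  case base
  show ?case using coeff_eq[of k k] by (simp del: power_int_minus)
next
  case (step i)
  have "(\<Sum>j=i+1..k. q powi (2 * int j - 2 * int k - 1)) =
      q powi (2 * int (i+1) - 2 * int k - 1) + (\<Sum>j=Suc i+1..k. q powi (2 * int j - 2 * int k - 1))"
    using step by (subst sum.atLeast_Suc_atMost) auto
  moreover have "q powi (2 * int i - 2 * int k - 1) = p\<^sup>2 * q powi (2 * int (i+1) - 2 * int k - 1)"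
  proof -
    have "k - i = Suc (k - (i+1))" using step by simp
    then show ?thesis using coeff_eq[of i k] coeff_eq[of "i+1" k] step by (simp add: power2_eq_square)
  qed
  ultimately show ?case using step.IH by (simp add: algebra_simps)
qed

text \<open>
  The terms \<open>w\<^sub>i = a * E k i * X (i-1)\<close> of the correction fall into four groups under \<open>g m\<close>.
  For \<open>i > m\<close>, the element \<open>a * E k i\<close> absorbs the generators below \<open>i - 1\<close>, so \<open>absorb_X_g\<close>
  applies to \<open>X (i-1)\<close> and yields a multiple of \<open>v = a * E k m\<close>. For \<open>i + 2 \<le> m\<close> the term just
  absorbs \<open>g m\<close>. The terms \<open>i = m\<close> and \<open>i = m - 1\<close> produce \<open>w\<^sub>m\<close>, \<open>w\<^sub>m\<^sub>-\<^sub>1\<close> and \<open>v\<close>; the ratio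
  \<open>p\<^sup>2\<close> of consecutive coefficients is the one for which \<open>w\<^sub>m\<close> and \<open>w\<^sub>m\<^sub>-\<^sub>1\<close> cancel.
  All that is left is \<open>v\<close>, whose coefficient is a telescoping geometric sum.
\<close>
lemma correction_sum_g:
  assumes a: "absorbs a k" and m: "1 \<le> m" "m \<le> k" and k: "k < n"
  defines "S \<equiv> (\<Sum>i=1..k. q powi (2 * int i - 2 * int k - 1) \<cdot> (E k i * X (i-1)))"
  shows "a * S * g m = p \<cdot> (a * S) + (p ^ (2*k) - p * inverse r) \<cdot> (a * E k m)"
proof -
  let ?Q = "qhat q" and ?R = "inverse r"
  define c where "c i = q powi (2 * int i - 2 * int k - 1)" for i
  define w where "w i = a * (E k i * X (i-1))" for i
  define v where "v = a * E k m"
  define \<delta> where "\<delta> i = w i * g m - p \<cdot> w i" for i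
  have above: "\<delta> i = - (p * ?R * ?Q) \<cdot> v" if "i \<in> {m+1..k}" for i
  proof -
    have "E k i * E (i-1) m = E k m" using that m by (intro descend_split) auto
    moreover have "absorbs (a * E k i) (i-1)" using that m by (intro absorbs_E[OF a k]) auto
    then have "a * E k i * X (i-1) * g m =
        p \<cdot> (a * E k i * X (i-1)) - (p * ?R * ?Q) \<cdot> (a * E k i * E (i-1) m)"
      by (rule absorb_X_g) (use that m k in auto)
    ultimately show ?thesis by (simp add: \<delta>_def w_def v_def mult.assoc)
  qed
  have below: "\<delta> i = 0" if "i \<in> {1..<m-1}" for i
  proof -
    have "X (i-1) * g m = g m * X (i-1)" using that m k by (intro X_commute gg_far) auto
    moreover have "i + 2 \<le> m" using that by auto
    ultimately show ?thesis using E_g_inner[OF a, of i m] that m k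
      by (simp add: \<delta>_def w_def mult.assoc) (simp flip: mult.assoc)
  qed
  have Em: "E k m = E k (m+1) * e m" using descend_right[of m k e] m by simp
  have eg': "E k m * g m = ?R \<cdot> E k m" using eg[of m] m k by (simp add: Em mult.assoc)
  have middle: "(\<Sum>i\<in>{m-1..m}\<inter>{1..}. c i \<cdot> \<delta> i) = (c m * (?R - p ^ (2*m-1))) \<cdot> v"
  proof (cases "m = 1")
    case True
    then have "{m-1..m}\<inter>{1..} = {1}" by auto
    then show ?thesis using True eg'
      by (simp add: \<delta>_def w_def v_def mult.assoc right_diff_distrib scale_left_diff_distrib scale_right_diff_distrib)
  next
    case False
    then obtain l where l: "m = l + 2" using m by (intro that[of "m-2"]) simp
    have Xl: "X (m-1) = 1 + p \<cdot> (g (m-1) * X l)" using l by simp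
    have Xlg: "X l * g m = g m * X l" using l m k by (intro X_commute gg_far) auto
    have Em1: "E k (m-1) = E k m * e (m-1)" using descend_right[of "m-1" k e] m l by simp
    have wm: "w m = v + p \<cdot> (a * (E k m * (g (m-1) * X l)))"
      unfolding w_def v_def Xl by (simp add: distribs mult.assoc)
    have "E k m * (g (m-1) * g m) = E k (m+1) * (e m * (g (m-1) * g m))"
      by (simp add: Em mult.assoc)
    also have "\<dots> = E k (m-1)"
      unfolding Em1 Em mult.assoc using e_gg_up[of "m-1"] l m k by simp
    finally have EE: "E k m * (g (m-1) * g m) = E k (m-1)" .
    have "E k m * (X (m-1) * g m) = E k m * g m + p \<cdot> (E k m * (g (m-1) * g m) * X l)"
      unfolding Xl by (simp add: distribs Xlg mult.assoc)
    then have EX: "E k m * (X (m-1) * g m) = ?R \<cdot> E k m + p \<cdot> (E k (m-1) * X l)"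
      by (simp only: EE eg')
    have wl: "w (m-1) = a * (E k (m-1) * X l)" using l by (simp add: w_def)
    have "w m * g m = a * (E k m * (X (m-1) * g m))" by (simp only: w_def mult.assoc)
    then have 1: "w m * g m = ?R \<cdot> v + p \<cdot> w (m-1)"
      by (simp only: EX wl v_def distribs mult_scale_right)
    have "w (m-1) * g m = a * E k (m-1) * g (m-1+1) * X l"
      using m by (simp only: wl mult.assoc Xlg le_add_diff_inverse2)
    also have "\<dots> = a * E k m * ginv (m-1) * X l"
      using E_g_adjacent[OF a, of "m-1"] l m k by simp
    also have "\<dots> = a * (E k m * (g (m-1) * X l)) - ?Q \<cdot> (a * E k m * X l) + ?Q \<cdot> w (m-1)"
      unfolding wl Em1 ginv_def by (simp add: algebra_simps)
    also have "a * E k m * X l = (\<Sum>j\<le>l. p ^ (2*j)) \<cdot> v"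
      using absorbs_E[OF a k, of m] m l by (subst absorb_X) (auto simp: v_def)
    also have "a * (E k m * (g (m-1) * X l)) = inverse p \<cdot> (w m - v)"
      using p0 by (simp add: wm)
    finally have 2: "w (m-1) * g m = inverse p \<cdot> (w m - v) - (?Q * (\<Sum>j\<le>l. p ^ (2*j))) \<cdot> v + ?Q \<cdot> w (m-1)"
      by simp
    have "(1 - p\<^sup>2) * (\<Sum>j\<le>l. (p\<^sup>2) ^ j) = 1 - (p\<^sup>2) ^ Suc l"
      by (rule sum_gp_basic)
    then have gs: "(1 - p\<^sup>2) * (\<Sum>j\<le>l. p ^ (2*j)) = 1 - p\<^sup>2 ^ Suc l" by (simp add: power_mult)
    have "p * (p * ?Q * (\<Sum>j\<le>l. p ^ (2*j))) = - p * ((1 - p\<^sup>2) * (\<Sum>j\<le>l. p ^ (2*j)))"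
      using p0 by (simp add: qhat_p algebra_simps power2_eq_square)
    also have "\<dots> = p ^ (2*m-1) - p"
      unfolding gs by (simp add: l power_mult[symmetric] algebra_simps, simp add: power2_eq_square)
    finally have geom: "p * (p * ?Q * (\<Sum>j\<le>l. p ^ (2*j))) = p ^ (2*m-1) - p" .
    have cc: "c (m-1) = c m * p\<^sup>2"
    proof -
      have "k - (m-1) = Suc (k - m)" using m by simp
      then show ?thesis using coeff_eq[of "m-1" k] coeff_eq[of m k] m by (simp add: c_def power2_eq_square)
    qed
    have "{m-1..m}\<inter>{1..} = {m-1, m}" using l by auto
    then have "(\<Sum>i\<in>{m-1..m}\<inter>{1..}. c i \<cdot> \<delta> i) = c (m-1) \<cdot> \<delta> (m-1) + c m \<cdot> \<delta> m"
      using l by simp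
    also have "\<dots> = c m \<cdot> (p\<^sup>2 \<cdot> \<delta> (m-1) + \<delta> m)"
      unfolding cc by (simp add: scale_right_distrib)
    also have "p\<^sup>2 \<cdot> \<delta> (m-1) + \<delta> m = (?R - p - p * (p * ?Q * (\<Sum>j\<le>l. p ^ (2*j)))) \<cdot> v
        + (p\<^sup>2 * (?Q - p) + p) \<cdot> w (m-1) + (p\<^sup>2 * inverse p - p) \<cdot> w m"
      using p0 unfolding \<delta>_def 1 2
      by (simp add: scale_right_distrib scale_left_distrib scale_left_diff_distrib
          scale_right_diff_distrib power2_eq_square algebra_simps)
    also have "p\<^sup>2 * (?Q - p) + p = 0" using p0 by (simp add: qhat_p power2_eq_square)
    also have "p\<^sup>2 * inverse p - p = 0" using p0 by (simp add: power2_eq_square)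
    finally show ?thesis unfolding geom by simp
  qed
  have "a * S * g m - p \<cdot> (a * S) = (\<Sum>i=1..k. c i \<cdot> \<delta> i)"
    by (simp add: S_def \<delta>_def w_def c_def sum_distrib_left sum_distrib_right scale_sum_right
        scale_right_diff_distrib sum_subtractf mult.assoc mult.commute)
  also have "{1..k} = {1..<m-1} \<union> (({m-1..m}\<inter>{1..}) \<union> {m+1..k})" using m by auto
  also have "(\<Sum>i\<in>\<dots>. c i \<cdot> \<delta> i) = (c m * (?R - p ^ (2*m-1))) \<cdot> v + (\<Sum>i=m+1..k. c i \<cdot> \<delta> i)"
    using m by (subst sum.union_disjoint, simp, simp, force)+ (simp only: middle, simp add: below)
  also have "(\<Sum>i=m+1..k. c i \<cdot> \<delta> i) = ((\<Sum>i=m+1..k. c i) * - (p * ?R * ?Q)) \<cdot> v"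
    using above by (simp add: scale_sum_left sum_distrib_right sum_negf)
  also have "(\<Sum>i=m+1..k. c i) * - (p * ?R * ?Q) = (1 - p\<^sup>2) * (\<Sum>i=m+1..k. c i) * ?R"
    using p0 by (simp add: qhat_p algebra_simps power2_eq_square)
  also have "(1 - p\<^sup>2) * (\<Sum>i=m+1..k. c i) = - p - c m"
    unfolding c_def using coeff_sum[of m k] m by simp
  also have "(c m * (?R - p ^ (2*m-1))) \<cdot> v + ((- p - c m) * ?R) \<cdot> v =
      (- (c m * p ^ (2*m-1)) - p * ?R) \<cdot> v"
    by (simp add: algebra_simps flip: scale_left_distrib)
  also have "- (c m * p ^ (2*m-1)) = p ^ (2*k)"
  proof -
    have "2 * (k-m) + 1 + (2*m-1) = 2*k" using m by auto
    then show ?thesis unfolding c_def using coeff_eq[of m k] m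
      by (metis (no_types) minus_mult_left minus_minus power_add)
  qed
  finally show ?thesis by (simp add: v_def algebra_simps)
qed

lemma ab_denom:
  assumes "k \<ge> 1"
  shows "q powi (- 2 * int k + 1) = - (p ^ (2*k-1))" "1 - p ^ (2*k-1) * r \<noteq> 0"
proof -
  have "- 2 * int k + 1 = - int (2*k-1)" using assms by auto
  then have "q powi (- 2 * int k + 1) = inverse q ^ (2*k-1)"
    by (simp only: power_int_minus power_int_of_nat power_inverse)
  also have "odd (2*k-1)" using assms by simp
  then have "inverse q ^ (2*k-1) = - (p ^ (2*k-1))" by (simp add: p_def)
  finally show 1: "q powi (- 2 * int k + 1) = - (p ^ (2*k-1))" .
  have "r \<noteq> - (q powi int (2*k-1))" using params unfolding bwm_params_def by blast
  moreover have "q powi int (2*k-1) * p ^ (2*k-1) = - 1"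
    using \<open>odd (2*k-1)\<close> q0 unfolding power_int_of_nat p_def power_mult_distrib[symmetric] by simp
  ultimately show "1 - p ^ (2*k-1) * r \<noteq> 0"
  proof (intro notI)
    assume *: "1 - p ^ (2*k-1) * r = 0" "r \<noteq> - (q powi int (2*k-1))"
      "q powi int (2*k-1) * p ^ (2*k-1) = - 1"
    then have "q powi int (2*k-1) * (p ^ (2*k-1) * r) = q powi int (2*k-1)" by simp
    moreover have "q powi int (2*k-1) * (p ^ (2*k-1) * r) = - r"
      unfolding mult.assoc[symmetric] *(3) by simp
    ultimately show False using *(2) by (metis minus_minus)
  qed
qed

text \<open>
  The defect \<open>- (p * inverse r * qhat q) \<cdot> v\<close> of \<open>X k\<close> and the defect
  \<open>(p ^ (2*k) - p * inverse r) \<cdot> v\<close> of the correction are proportional, with a ratio independent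
  of \<open>m\<close>, and \<open>ab_coeff r q k\<close> is this ratio.
\<close>
theorem recursion_factor_absorbs:
  assumes a: "absorbs a k" and k: "k < n"
  shows "absorbs (a * recursion_factor scale g e r q k) (k+1)"
proof (intro allI impI)
  fix m assume "1 \<le> m" "m < k + 1"
  then have m: "1 \<le> m" "m \<le> k" by auto
  define S where "S = (\<Sum>i=1..k. q powi (2 * int i - 2 * int k - 1) \<cdot> (E k i * X (i-1)))"
  define d where "d = 1 - p ^ (2*k-1) * r"
  have d: "d \<noteq> 0" using ab_denom(2)[of k] m by (simp add: d_def)
  have b: "recursion_factor scale g e r q k = X k - (qhat q / d) \<cdot> S"
    using ab_denom(1)[of k] m by (simp add: recursion_factor_def p_def[symmetric] S_def ab_coeff_def d_def)
  have "p ^ (2*k) = p * p ^ (2*k-1)" using m by (simp add: power_eq_if)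
  then have "p ^ (2*k) - p * inverse r = - (p * inverse r) * d"
    using r0 by (simp add: d_def algebra_simps)
  then have "(qhat q / d) * (p ^ (2*k) - p * inverse r) = - (p * inverse r * qhat q)"
    using d by simp
  note kappa = this
  let ?b = "recursion_factor scale g e r q k" and ?v = "a * E k m"
  have "a * ?b * g m = a * X k * g m - (qhat q / d) \<cdot> (a * S * g m)"
    by (simp add: b right_diff_distrib left_diff_distrib)
  also have "\<dots> = p \<cdot> (a * X k) - (p * inverse r * qhat q) \<cdot> ?v
      - (qhat q / d * p) \<cdot> (a * S) - (qhat q / d * (p ^ (2*k) - p * inverse r)) \<cdot> ?v"
    unfolding absorb_X_g[OF a m k] correction_sum_g[OF a m k, folded S_def]
    by (simp only: scale_right_distrib scale_scale diff_diff_eq add.assoc)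
  also have "\<dots> = p \<cdot> (a * ?b)"
    unfolding kappa by (simp add: b right_diff_distrib scale_right_diff_distrib mult.commute)
  finally show "a * ?b * g m = p \<cdot> (a * ?b)" .
qed

end

section \<open>The recursion and homomorphisms\<close>

primrec antisymmetrizer_rec ::
    "(complex \<Rightarrow> 'a::ring_1 \<Rightarrow> 'a) \<Rightarrow> (nat \<Rightarrow> 'a) \<Rightarrow> (nat \<Rightarrow> 'a) \<Rightarrow> complex \<Rightarrow> complex \<Rightarrow> nat \<Rightarrow> 'a" where
  "antisymmetrizer_rec scale g e r q 0 = 1"
| "antisymmetrizer_rec scale g e r q (Suc k) = scale (q ^ k / qnum q (int (Suc k)))
     (antisymmetrizer_rec scale g e r q k * recursion_factor scale g e r q k)"

lemma (in bwm_rep) antisymmetrizer_rec_absorbs: "m \<le> n \<Longrightarrow> absorbs (antisymmetrizer_rec scale g e r q m) m"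
proof (induction m)
  case (Suc k)
  then have "absorbs (antisymmetrizer_rec scale g e r q k * recursion_factor scale g e r q k) (k+1)"
    by (intro recursion_factor_absorbs) auto
  then show ?case by (simp add: mult.commute)
qed simp

definition algebra_hom ::
    "(complex \<Rightarrow> 'a::ring_1 \<Rightarrow> 'a) \<Rightarrow> (complex \<Rightarrow> 'b::ring_1 \<Rightarrow> 'b) \<Rightarrow> ('a \<Rightarrow> 'b) \<Rightarrow> bool" where
  "algebra_hom s s' \<phi> \<longleftrightarrow> (\<forall>x y. \<phi> (x + y) = \<phi> x + \<phi> y) \<and> (\<forall>x y. \<phi> (x * y) = \<phi> x * \<phi> y) \<and>
     \<phi> 1 = 1 \<and> (\<forall>c x. \<phi> (s c x) = s' c (\<phi> x))"

lemma algebra_homD: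
  assumes "algebra_hom s s' \<phi>"
  shows "\<phi> (x + y) = \<phi> x + \<phi> y" "\<phi> (x * y) = \<phi> x * \<phi> y" "\<phi> 1 = 1" "\<phi> (s c x) = s' c (\<phi> x)"
    "\<phi> 0 = 0" "\<phi> (- x) = - \<phi> x" "\<phi> (x - y) = \<phi> x - \<phi> y"
    "\<phi> (sum f A) = (\<Sum>a\<in>A. \<phi> (f a))" "\<phi> (prod_list xs) = prod_list (map \<phi> xs)"
proof -
  note * = assms[unfolded algebra_hom_def]
  show add: "\<phi> (x + y) = \<phi> x + \<phi> y" for x y using * by blast
  show "\<phi> (x * y) = \<phi> x * \<phi> y" "\<phi> 1 = 1" "\<phi> (s c x) = s' c (\<phi> x)" using * by blast+
  show z: "\<phi> 0 = 0" using add[of 0 0] by simp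
  show m: "\<phi> (- x) = - \<phi> x" for x using add[of x "- x"] by (simp add: z eq_neg_iff_add_eq_0 add.commute)
  show "\<phi> (x - y) = \<phi> x - \<phi> y" using add[of x "- y"] by (simp add: m)
  show "\<phi> (sum f A) = (\<Sum>a\<in>A. \<phi> (f a))"
    by (induction A rule: infinite_finite_induct) (simp_all add: z add)
  show "\<phi> (prod_list xs) = prod_list (map \<phi> xs)"
    by (induction xs) (use * in simp_all)
qed

lemma hom_recursion_factor:
  assumes "algebra_hom s s' \<phi>"
  shows "\<phi> (recursion_factor s g e r q k) = recursion_factor s' (\<lambda>i. \<phi> (g i)) (\<lambda>i. \<phi> (e i)) r q k"
proof -
  note h = algebra_homD[OF assms]
  have "\<phi> (staircase s g p k) = staircase s' (\<lambda>i. \<phi> (g i)) p k" for p k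
    by (induction k) (simp_all add: h)
  then show ?thesis
    by (simp add: recursion_factor_def descend_def h comp_def del: upt_Suc)
qed

lemma hom_antisymmetrizer_rec:
  assumes "algebra_hom s s' \<phi>"
  shows "\<phi> (antisymmetrizer_rec s g e r q m) = antisymmetrizer_rec s' (\<lambda>i. \<phi> (g i)) (\<lambda>i. \<phi> (e i)) r q m"
  by (induction m) (simp_all add: algebra_homD[OF assms] hom_recursion_factor[OF assms])

lemma recursion_factor_closed:
  assumes S: "1 \<in> S" "\<And>x y. x \<in> S \<Longrightarrow> y \<in> S \<Longrightarrow> x + y \<in> S" "\<And>x y. x \<in> S \<Longrightarrow> y \<in> S \<Longrightarrow> x - y \<in> S"
      "\<And>x y. x \<in> S \<Longrightarrow> y \<in> S \<Longrightarrow> x * y \<in> S" "\<And>c x. x \<in> S \<Longrightarrow> scale c x \<in> S"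
    and gens: "\<And>i. 1 \<le> i \<Longrightarrow> i < n \<Longrightarrow> g i \<in> S \<and> e i \<in> S" and "k < n"
  shows "recursion_factor scale g e r q k \<in> S"
proof -
  have 0: "0 \<in> S" using S(3)[OF S(1) S(1)] by simp
  have sum: "sum f A \<in> S" if "\<And>a. a \<in> A \<Longrightarrow> f a \<in> S" for f :: "nat \<Rightarrow> 'a" and A
    using that by (induction A rule: infinite_finite_induct) (auto intro: 0 S)
  have prod: "prod_list (map e xs) \<in> S" if "set xs \<subseteq> {1..<n}" for xs
    using that by (induction xs) (auto intro!: S gens[THEN conjunct2])
  have "staircase scale g p k \<in> S" if "k < n" for p k
    using that by (induction k) (auto intro!: S gens[THEN conjunct1])
  then show ?thesis
    unfolding recursion_factor_def descend_def using \<open>k < n\<close>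
    by (auto intro!: S sum prod simp del: upt_Suc)
qed

lemma antisymmetrizer_rec_closed:
  assumes S: "1 \<in> S" "\<And>x y. x \<in> S \<Longrightarrow> y \<in> S \<Longrightarrow> x + y \<in> S" "\<And>x y. x \<in> S \<Longrightarrow> y \<in> S \<Longrightarrow> x - y \<in> S"
      "\<And>x y. x \<in> S \<Longrightarrow> y \<in> S \<Longrightarrow> x * y \<in> S" "\<And>c x. x \<in> S \<Longrightarrow> scale c x \<in> S"
    and gens: "\<And>i. 1 \<le> i \<Longrightarrow> i < n \<Longrightarrow> g i \<in> S \<and> e i \<in> S" and "m \<le> n"
  shows "antisymmetrizer_rec scale g e r q m \<in> S"
  using \<open>m \<le> n\<close>
proof (induction m)
  case (Suc k)
  then show ?case using recursion_factor_closed[OF S gens, where k = k] by (auto intro!: S)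
qed (simp add: S)

text \<open>
  In the one-dimensional representation \<open>g i \<mapsto> - 1 / q\<close>, \<open>e i \<mapsto> 0\<close> the correction vanishes and
  the factor is \<open>\<Sum>j\<le>k. q\<^sup>-\<^sup>2\<^sup>j\<close>. This explains the normalization: it is the one that gives the
  antisymmetrizer the value 1 in this representation.
\<close>
lemma recursion_factor_trivial:
  assumes "bwm_params r q"
  shows "q ^ k / qnum q (int (Suc k)) * recursion_factor (*) (\<lambda>_. - inverse q) (\<lambda>_. 0) r q k = 1"
proof -
  have q: "q \<noteq> 0" "q ^ Suc j \<noteq> 1" for j using assms by (auto simp: bwm_params_def)
  have q2: "q\<^sup>2 \<noteq> 1" using q(2)[of 1] by (simp add: numeral_2_eq_2)
  define t where "t = staircase (*) (\<lambda>_. - inverse q) (- inverse q) k"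
  have t: "(q\<^sup>2 - 1) * t = q\<^sup>2 - inverse q ^ (2*k)"
  proof (unfold t_def, induction k)
    case (Suc k)
    have "(q\<^sup>2 - 1) * staircase (*) (\<lambda>_. - inverse q) (- inverse q) (Suc k) =
        q\<^sup>2 - 1 + inverse q * inverse q * ((q\<^sup>2 - 1) * staircase (*) (\<lambda>_. - inverse q) (- inverse q) k)"
      by (simp add: algebra_simps)
    then show ?case unfolding Suc using q(1) by (simp add: algebra_simps power2_eq_square)
  qed simp
  have "descend (\<lambda>_. 0) k i = (0::complex)" if "i \<le> k" for i
    using descend_right[OF that, of "\<lambda>_. 0::complex"] by simp
  then have "recursion_factor (*) (\<lambda>_. - inverse q) (\<lambda>_. 0) r q k = t"
    by (simp add: recursion_factor_def t_def)
  moreover have "q ^ k * t = qnum q (int (Suc k))"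
  proof -
    have "q - inverse q = (q\<^sup>2 - 1) / q" using q(1) by (simp add: field_simps power2_eq_square)
    moreover have "q powi (int (Suc k)) - q powi (- int (Suc k)) = q ^ k * ((q\<^sup>2 - 1) * t) / q"
      unfolding t power_int_minus power_int_of_nat using q(1)
      by (simp add: field_simps power2_eq_square) (simp add: power_mult power2_eq_square)
    ultimately show ?thesis using q(1) q2 by (simp add: qnum_def)
  qed
  moreover have "qnum q (int (Suc k)) \<noteq> 0"
  proof
    assume "qnum q (int (Suc k)) = 0"
    then have "q ^ Suc k - inverse (q ^ Suc k) = 0 \<or> q\<^sup>2 = 1"
      using q(1) unfolding qnum_def power_int_minus power_int_of_nat
      by (auto simp: field_simps power2_eq_square)
    then have "q ^ Suc k * q ^ Suc k = 1" using q(1) q2 by (auto simp: field_simps)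
    then have "q ^ Suc (k + Suc k) = 1" by (simp add: power_add mult_ac)
    then show False using q(2) by blast
  qed
  ultimately show ?thesis by simp
qed

lemma antisymmetrizer_rec_trivial:
  "bwm_params r q \<Longrightarrow> antisymmetrizer_rec (*) (\<lambda>_. - inverse q) (\<lambda>_. 0) r q m = 1"
  using recursion_factor_trivial by (induction m) simp_all

section \<open>Opposite, flipped and shifted generators\<close>

typedef 'a opposite = "UNIV :: 'a set" morphisms of_op to_op by simp

setup_lifting type_definition_opposite

instantiation opposite :: (ring_1) ring_1
begin
lift_definition zero_opposite :: "'a opposite" is 0 .
lift_definition one_opposite :: "'a opposite" is 1 .
lift_definition plus_opposite :: "'a opposite \<Rightarrow> 'a opposite \<Rightarrow> 'a opposite" is "(+)" .
lift_definition minus_opposite :: "'a opposite \<Rightarrow> 'a opposite \<Rightarrow> 'a opposite" is "(-)" .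
lift_definition uminus_opposite :: "'a opposite \<Rightarrow> 'a opposite" is uminus .
lift_definition times_opposite :: "'a opposite \<Rightarrow> 'a opposite \<Rightarrow> 'a opposite" is "\<lambda>x y. y * x" .
instance by standard (transfer; simp add: algebra_simps)+
end

lemmas op_simps = zero_opposite.rep_eq one_opposite.rep_eq plus_opposite.rep_eq minus_opposite.rep_eq
  uminus_opposite.rep_eq times_opposite.rep_eq to_op_inverse[OF UNIV_I] of_op_inverse

definition op_scale :: "(complex \<Rightarrow> 'a \<Rightarrow> 'a) \<Rightarrow> complex \<Rightarrow> 'a opposite \<Rightarrow> 'a opposite" where
  "op_scale scale c x = to_op (scale c (of_op x))"

lemma of_op_scale [simp]: "of_op (op_scale scale c x) = scale c (of_op x)"
  by (simp add: op_scale_def op_simps)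

context bwm_rep begin

text \<open>
  Reversing words turns the last two families of relations into \<open>e_gg_down\<close> and \<open>e_gg_up\<close>.
\<close>
lemma bwm_rep_opposite: "bwm_rep (op_scale scale) (\<lambda>i. to_op (g i)) (\<lambda>i. to_op (e i)) r q n"
proof unfold_locales
  fix i assume i: "1 \<le> i" "i + 1 < n"
  show "to_op (g i) * (to_op (g (i+1)) * to_op (e i)) = to_op (e (i+1)) * to_op (e i)"
    using e_gg_down[OF i] by (simp add: of_op_inject[symmetric] op_simps mult.assoc)
  show "to_op (g (i+1)) * (to_op (g i) * to_op (e (i+1))) = to_op (e i) * to_op (e (i+1))"
    using e_gg_up[OF i] by (simp add: of_op_inject[symmetric] op_simps mult.assoc)
  show "to_op (g i) * (to_op (g (i+1)) * to_op (g i)) = to_op (g (i+1)) * (to_op (g i) * to_op (g (i+1)))"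
    using braid[OF i] by (simp add: of_op_inject[symmetric] op_simps mult.assoc)
next
  fix i assume i: "1 \<le> i" "i < n"
  show "to_op (g i) * to_op (g i) =
      1 + op_scale scale (qhat q) (to_op (g i)) - op_scale scale (inverse r * qhat q) (to_op (e i))"
    using g_square[OF i] by (simp add: of_op_inject[symmetric] op_simps)
  show "to_op (g i) * to_op (e i) = op_scale scale (inverse r) (to_op (e i))"
    "to_op (e i) * to_op (g i) = op_scale scale (inverse r) (to_op (e i))"
    using ge[OF i] eg[OF i] by (simp_all add: of_op_inject[symmetric] op_simps)
next
  fix i j assume "1 \<le> i" "i + 1 < j" "j < n"
  then show "to_op (g i) * to_op (g j) = to_op (g j) * to_op (g i)"
    using gg_commute[of i j] by (simp add: of_op_inject[symmetric] op_simps)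
qed (simp_all add: of_op_inject[symmetric] op_simps params scale_left_distrib scale_right_distrib)

lemma bwm_rep_flip: "bwm_rep scale (\<lambda>i. g (n-i)) (\<lambda>i. e (n-i)) r q n"
proof unfold_locales
  fix i assume i: "1 \<le> i" "i + 1 < n"
  then have i': "n - i = n - (i+1) + 1" "1 \<le> n - (i+1)" "n - (i+1) + 1 < n" by auto
  show "g (n-i) * (g (n-(i+1)) * g (n-i)) = g (n-(i+1)) * (g (n-i) * g (n-(i+1)))"
    unfolding i'(1) using braid[OF i'(2,3)] by simp
  show "g (n-i) * (g (n-(i+1)) * e (n-i)) = e (n-(i+1)) * e (n-i)"
    unfolding i'(1) using gge_down[OF i'(2,3)] by simp
  show "g (n-(i+1)) * (g (n-i) * e (n-(i+1))) = e (n-i) * e (n-(i+1))"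
    unfolding i'(1) using gge_up[OF i'(2,3)] by simp
qed (auto simp: params intro!: g_square ge eg gg_far)

lemma bwm_rep_shift: "bwm_rep scale (\<lambda>i. g (i+1)) (\<lambda>i. e (i+1)) r q (n-1)"
proof unfold_locales
  fix i assume "1 \<le> i" "i + 1 < n - 1"
  then have i: "1 \<le> i + 1" "i + 1 + 1 < n" by auto
  show "g (i+1) * (g (i+1+1) * g (i+1)) = g (i+1+1) * (g (i+1) * g (i+1+1))" by (rule braid[OF i])
  show "g (i+1) * (g (i+1+1) * e (i+1)) = e (i+1+1) * e (i+1)" by (rule gge_up[OF i])
  show "g (i+1+1) * (g (i+1) * e (i+1+1)) = e (i+1) * e (i+1+1)" by (rule gge_down[OF i])
qed (auto simp: params intro!: g_square ge eg gg_far)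

lemma bwm_rep_mono: "m \<le> n \<Longrightarrow> bwm_rep scale g e r q m"
  by unfold_locales (auto simp: params intro!: braid[simplified] g_square ge eg gge_up[simplified] gge_down[simplified] gg_commute)

end

section \<open>The augmentation\<close>

abbreviation fscale :: "complex \<Rightarrow> bwm_poly \<Rightarrow> bwm_poly" where
  "fscale c p \<equiv> fconst c * p"

text \<open>
  The one-dimensional representation \<open>g i \<mapsto> - 1 / q\<close>, \<open>e i \<mapsto> 0\<close> as a character of the free
  algebra. An element that absorbs all \<open>g i\<close> absorbs every polynomial through this character.
\<close>
definition augment_letter :: "complex \<Rightarrow> bwm_letter \<Rightarrow> complex" where
  "augment_letter q x = (case x of LG _ \<Rightarrow> - inverse q | LE _ \<Rightarrow> 0)"

definition augment :: "complex \<Rightarrow> bwm_poly \<Rightarrow> complex" where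
  "augment q p = Poly_Mapping.lookup (fsubst (\<lambda>x. fconst (augment_letter q x)) p) 0"

lemma lookup_fconst [simp]: "Poly_Mapping.lookup (fconst c) 0 = c"
  by (simp add: fconst_def)

lemma fconst_prod_list: "prod_list (map (\<lambda>x. fconst (f x)) xs) = fconst (prod_list (map f xs))"
  by (induction xs) (simp_all add: fconst_1 fconst_mult)

lemma fconst_sum: "(\<Sum>x\<in>A. fconst (f x)) = fconst (sum f A)"
  by (induction A rule: infinite_finite_induct) (simp_all add: fconst_0 fconst_add)

lemma augment_eq:
  "augment q p = (\<Sum>w\<in>Poly_Mapping.keys p. Poly_Mapping.lookup p w * prod_list (map (augment_letter q) (letters w)))"
  by (simp add: augment_def fsubst_def fconst_prod_list fconst_sum flip: fconst_mult)

lemma fsubst_augment: "fsubst (\<lambda>x. fconst (augment_letter q x)) p = fconst (augment q p)"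
  by (simp add: augment_eq fsubst_def fconst_prod_list fconst_sum flip: fconst_mult)

lemma augment_hom: "algebra_hom fscale (*) (augment q)"
  unfolding algebra_hom_def
proof (intro conjI allI)
  fix x y and c
  show "augment q (x + y) = augment q x + augment q y"
    by (simp only: augment_def fsubst_add lookup_add)
  show "augment q (x * y) = augment q x * augment q y"
    unfolding augment_def[of _ "x * y"] fsubst_mult
    unfolding fsubst_augment by (simp flip: fconst_mult)
  show "augment q (fconst c * x) = c * augment q x"
    unfolding augment_def[of _ "fconst c * x"] fsubst_mult fsubst_fconst
    unfolding fsubst_augment by (simp flip: fconst_mult)
  show "augment q 1 = 1" using lookup_fconst[of 1] by (simp add: augment_def fconst_1)
qed

lemmas augment_simps = algebra_homD[OF augment_hom]

lemma augment_gens [simp]: "augment q (fg i) = - inverse q" "augment q (fe i) = 0" "augment q (fconst c) = c"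
  by (simp_all add: augment_def augment_letter_def)

lemma augment_bwm_ideal:
  assumes "q \<noteq> 0" "p \<in> bwm_ideal r q n" shows "augment q p = 0"
proof -
  interpret R: ring "free_alg n" by (rule ring_free_alg)
  let ?\<psi> = "\<lambda>x. fconst (augment_letter q x)"
  have closed: "?\<psi> x \<in> carrier (free_alg 0)" for x by simp
  interpret h: ring_hom_ring "free_alg n" "free_alg 0" "fsubst ?\<psi>"
    by (intro ring_hom_ringI2 ring_free_alg fsubst_ring_hom closed)
  have "ideal {p \<in> carrier (free_alg n). fsubst ?\<psi> p \<in> {\<zero>\<^bsub>free_alg 0\<^esub>}} (free_alg n)"
    by (rule h.ideal_vimage) (rule ring.zeroideal[OF ring_free_alg])
  moreover have "augment q p = 0" if "p \<in> bwm_relators r q n" for p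
    using that assms(1)
    unfolding bwm_relators_def power2_eq_square
    by (auto simp: augment_simps) (simp add: qhat_def field_simps)
  then have "bwm_relators r q n \<subseteq> {p \<in> carrier (free_alg n). fsubst ?\<psi> p \<in> {\<zero>\<^bsub>free_alg 0\<^esub>}}"
    using bwm_relators_subset[THEN subsetD] by (auto simp: fsubst_augment fconst_0 free_alg_simps)
  ultimately have "bwm_ideal r q n \<subseteq> {p \<in> carrier (free_alg n). fsubst ?\<psi> p \<in> {\<zero>\<^bsub>free_alg 0\<^esub>}}"
    unfolding bwm_ideal_def by (rule R.genideal_minimal)
  then have "fconst (augment q p) = 0" using assms(2) by (auto simp: fsubst_augment free_alg_simps)
  then show ?thesis by (metis lookup_fconst lookup_zero)
qed

section \<open>A single ring type for all Birman--Wenzl--Murakami algebras\<close>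

text \<open>
  The algebras \<open>BWM r q n\<close> have carriers that depend on the parameters, so no single type is one
  of them. Their product over all parameters, however, is a quotient of a function type by a
  relation without parameters, and it is an instance of \<open>ring_1\<close>. A fixed \<open>BWM r q n\<close> embeds
  unitally: its own component carries the class of the polynomial, and all other components
  carry the scalar given by the augmentation. In this way computations in the type class
  decide equalities of cosets.
\<close>

text \<open>
  Sending the surplus letters to 0 extends the ideal of \<open>free_alg n\<close> to an ideal of the full
  free algebra that meets \<open>free_alg n\<close> in the original ideal.
\<close>
definition truncate_letters :: "nat \<Rightarrow> bwm_poly \<Rightarrow> bwm_poly" where
  "truncate_letters n = fsubst (\<lambda>x. if x \<in> bwm_letters n then fletter x else 0)"

lemma truncate_letters_closed [simp]: "truncate_letters n p \<in> carrier (free_alg n)"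
proof -
  have *: "prod_list (map (\<lambda>x. if x \<in> bwm_letters n then fletter x else 0) xs) \<in> carrier (free_alg n)" for xs
    by (induction xs) (auto intro!: carrier_free_alg_closed letter_in_free_alg)
  have sum: "sum f K \<in> carrier (free_alg n)"
    if "\<And>w. w \<in> K \<Longrightarrow> f w \<in> carrier (free_alg n)" for f :: "bwm_word \<Rightarrow> bwm_poly" and K
    using that by (induction K rule: infinite_finite_induct) (auto intro: carrier_free_alg_closed)
  show ?thesis
    unfolding truncate_letters_def fsubst_def by (intro sum carrier_free_alg_closed const_in_free_alg *)
qed

lemma truncate_letters_id:
  assumes "p \<in> carrier (free_alg n)" shows "truncate_letters n p = p"
proof -
  have "truncate_letters n p = fsubst fletter p"
    unfolding truncate_letters_def fsubst_def using assms
    by (intro sum.cong arg_cong2[where f = "(*)"] arg_cong[where f = prod_list] map_cong)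
      (auto simp: free_alg_def)
  then show ?thesis by (simp add: fsubst_id)
qed

definition bwm_kernel :: "complex \<times> complex \<times> nat \<Rightarrow> bwm_poly set" where
  "bwm_kernel = (\<lambda>(r, q, n). {p. truncate_letters n p \<in> bwm_ideal r q n})"

lemma bwm_kernel_iff: "p \<in> carrier (free_alg n) \<Longrightarrow> p \<in> bwm_kernel (r, q, n) \<longleftrightarrow> p \<in> bwm_ideal r q n"
  by (simp add: bwm_kernel_def truncate_letters_id)

lemma bwm_kernel_closed:
  shows kernel_0 [simp]: "0 \<in> bwm_kernel \<theta>"
    and kernel_add: "x \<in> bwm_kernel \<theta> \<Longrightarrow> y \<in> bwm_kernel \<theta> \<Longrightarrow> x + y \<in> bwm_kernel \<theta>"
    and kernel_minus: "x \<in> bwm_kernel \<theta> \<Longrightarrow> - x \<in> bwm_kernel \<theta>"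
    and kernel_left: "x \<in> bwm_kernel \<theta> \<Longrightarrow> z * x \<in> bwm_kernel \<theta>"
    and kernel_right: "x \<in> bwm_kernel \<theta> \<Longrightarrow> x * z \<in> bwm_kernel \<theta>"
proof -
  obtain r q n where \<theta>: "\<theta> = (r, q, n)" by (cases \<theta>)
  interpret I: ideal "bwm_ideal r q n" "free_alg n" by (rule ideal_bwm_ideal)
  note I = additive_subgroup.zero_closed[OF I.is_additive_subgroup]
    additive_subgroup.a_closed[OF I.is_additive_subgroup] I.I_l_closed I.I_r_closed
  note d = \<theta> bwm_kernel_def
  show 0: "0 \<in> bwm_kernel \<theta>" using I(1) by (simp add: d truncate_letters_def free_alg_simps)
  show "x \<in> bwm_kernel \<theta> \<Longrightarrow> y \<in> bwm_kernel \<theta> \<Longrightarrow> x + y \<in> bwm_kernel \<theta>"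
    using I(2) by (simp add: d truncate_letters_def fsubst_add free_alg_simps)
  have l: "z * x \<in> bwm_kernel \<theta>" if "x \<in> bwm_kernel \<theta>" for z x
    using I(3)[of "truncate_letters n x" "truncate_letters n z"] that by (simp add: d truncate_letters_def[of n] fsubst_mult free_alg_simps)
      (simp add: truncate_letters_closed flip: truncate_letters_def)
  show "x \<in> bwm_kernel \<theta> \<Longrightarrow> z * x \<in> bwm_kernel \<theta>" by (rule l)
  show "x \<in> bwm_kernel \<theta> \<Longrightarrow> - x \<in> bwm_kernel \<theta>" using l[of x "- 1"] by simp
  show "x \<in> bwm_kernel \<theta> \<Longrightarrow> x * z \<in> bwm_kernel \<theta>"
    using I(4)[of "truncate_letters n x" "truncate_letters n z"] by (simp add: d truncate_letters_def[of n] fsubst_mult free_alg_simps)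
      (simp add: truncate_letters_closed flip: truncate_letters_def)
qed

definition family_equiv ::
    "(complex \<times> complex \<times> nat \<Rightarrow> bwm_poly) \<Rightarrow> (complex \<times> complex \<times> nat \<Rightarrow> bwm_poly) \<Rightarrow> bool" where
  "family_equiv f f' \<longleftrightarrow> (\<forall>\<theta>. f \<theta> - f' \<theta> \<in> bwm_kernel \<theta>)"

lemma family_equiv_refl [simp]: "family_equiv f f"
  by (simp add: family_equiv_def)

quotient_type bwm_product = "complex \<times> complex \<times> nat \<Rightarrow> bwm_poly" / family_equiv
proof (rule equivpI)
  show "symp family_equiv"
    unfolding symp_def family_equiv_def by (metis kernel_minus minus_diff_eq)
  have "x - z \<in> bwm_kernel \<theta>" if "x - y \<in> bwm_kernel \<theta>" "y - z \<in> bwm_kernel \<theta>" for x y z \<theta>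
    using kernel_add[OF that] by simp
  then show "transp family_equiv"
    unfolding transp_def family_equiv_def by blast
qed (simp add: reflp_def)

instantiation bwm_product :: ring_1
begin
lift_definition zero_bwm_product :: bwm_product is "\<lambda>_. 0" .
lift_definition one_bwm_product :: bwm_product is "\<lambda>_. 1" .
lift_definition plus_bwm_product :: "bwm_product \<Rightarrow> bwm_product \<Rightarrow> bwm_product" is "\<lambda>f h \<theta>. f \<theta> + h \<theta>"
proof -
  fix f f' h h' assume "family_equiv f f'" "family_equiv h h'"
  then have "(f \<theta> - f' \<theta>) + (h \<theta> - h' \<theta>) \<in> bwm_kernel \<theta>" for \<theta>
    unfolding family_equiv_def by (blast intro: kernel_add)
  then show "family_equiv (\<lambda>\<theta>. f \<theta> + h \<theta>) (\<lambda>\<theta>. f' \<theta> + h' \<theta>)"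
    by (simp add: family_equiv_def algebra_simps)
qed
lift_definition uminus_bwm_product :: "bwm_product \<Rightarrow> bwm_product" is "\<lambda>f \<theta>. - f \<theta>"
  unfolding family_equiv_def by (metis kernel_minus minus_diff_minus)
lift_definition times_bwm_product :: "bwm_product \<Rightarrow> bwm_product \<Rightarrow> bwm_product" is "\<lambda>f h \<theta>. f \<theta> * h \<theta>"
proof -
  fix f f' h h' assume "family_equiv f f'" "family_equiv h h'"
  then have "(f \<theta> - f' \<theta>) * h \<theta> + f' \<theta> * (h \<theta> - h' \<theta>) \<in> bwm_kernel \<theta>" for \<theta>
    unfolding family_equiv_def by (blast intro: kernel_add kernel_left kernel_right)
  then show "family_equiv (\<lambda>\<theta>. f \<theta> * h \<theta>) (\<lambda>\<theta>. f' \<theta> * h' \<theta>)"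
    by (simp add: family_equiv_def algebra_simps)
qed
definition minus_bwm_product :: "bwm_product \<Rightarrow> bwm_product \<Rightarrow> bwm_product" where
  "minus_bwm_product x y = x + - y"
instance
proof
  have "(0::bwm_poly) - 1 \<notin> bwm_kernel (1, 1, 0)"
    using augment_bwm_ideal[of 1 "0 - 1" 1 0] carrier_free_alg_closed(4)[of 0 0 1]
    by (auto simp: bwm_kernel_iff augment_simps)
  then show "(0::bwm_product) \<noteq> 1" by transfer (auto simp: family_equiv_def)
  show "x - y = x + - y" for x y :: bwm_product by (simp add: minus_bwm_product_def)
qed (transfer, simp add: algebra_simps)+
end

lift_definition product_scale :: "complex \<Rightarrow> bwm_product \<Rightarrow> bwm_product" is "\<lambda>c f \<theta>. fconst c * f \<theta>"
  unfolding family_equiv_def right_diff_distrib[symmetric] by (blast intro: kernel_left)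

lemma family_equiv_eqI: "(\<And>\<theta>. f \<theta> = f' \<theta>) \<Longrightarrow> family_equiv f f'"
  by (simp add: family_equiv_def)

interpretation bwm_product: complex_algebra product_scale
proof
  fix c d and x y :: bwm_product
  show "x * product_scale c y = product_scale c (x * y)"
  proof (transfer, rule family_equiv_eqI)
    fix c and x y :: "complex \<times> complex \<times> nat \<Rightarrow> bwm_poly" and \<theta>
    show "x \<theta> * (fconst c * y \<theta>) = fconst c * (x \<theta> * y \<theta>)"
      using fconst_commute[of c "x \<theta>"] by (simp flip: mult.assoc)
  qed
  show "product_scale c x * y = product_scale c (x * y)"
    by (transfer, rule family_equiv_eqI) (simp add: mult.assoc)
  show "product_scale c (x + y) = product_scale c x + product_scale c y"
    by (transfer, rule family_equiv_eqI) (simp add: distrib_left)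
  show "product_scale (c + d) x = product_scale c x + product_scale d x"
    by (transfer, rule family_equiv_eqI) (simp add: distrib_right fconst_add)
  show "product_scale c (product_scale d x) = product_scale (c * d) x"
    by (transfer, rule family_equiv_eqI) (simp add: mult.assoc fconst_mult)
  show "product_scale 1 x = x"
    by (transfer, rule family_equiv_eqI) (simp add: fconst_1)
qed

lift_definition to_product :: "complex \<Rightarrow> complex \<Rightarrow> nat \<Rightarrow> bwm_poly \<Rightarrow> bwm_product"
  is "\<lambda>r q n p \<theta>. if \<theta> = (r, q, n) then p else fconst (augment q p)" .

lemma to_product_hom: "algebra_hom fscale product_scale (to_product r q n)"
  unfolding algebra_hom_def
proof (intro conjI allI)
  fix x y c
  let ?t = "to_product r q n"
  show "?t (x + y) = ?t x + ?t y"
    by (transfer, rule family_equiv_eqI) (simp add: augment_simps fconst_add)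
  show "?t (x * y) = ?t x * ?t y"
    by (transfer, rule family_equiv_eqI) (simp add: augment_simps fconst_mult)
  show "?t 1 = 1"
    by (transfer, rule family_equiv_eqI) (simp add: augment_simps fconst_1)
  show "?t (fconst c * x) = product_scale c (?t x)"
    by (transfer, rule family_equiv_eqI) (simp add: augment_simps fconst_mult)
qed

lemma to_product_eq_iff:
  assumes q: "q \<noteq> 0" and xy: "x \<in> carrier (free_alg n)" "y \<in> carrier (free_alg n)"
  shows "to_product r q n x = to_product r q n y \<longleftrightarrow> x - y \<in> bwm_ideal r q n"
proof -
  have "to_product r q n x = to_product r q n y \<longleftrightarrow>
      family_equiv (\<lambda>\<theta>. if \<theta> = (r, q, n) then x else fconst (augment q x))
        (\<lambda>\<theta>. if \<theta> = (r, q, n) then y else fconst (augment q y))" (is "?l \<longleftrightarrow> _")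
    by transfer (rule refl)
  also have "\<dots> \<longleftrightarrow> x - y \<in> bwm_kernel (r, q, n)" (is "?f \<longleftrightarrow> ?k")
  proof
    assume ?f
    from this[unfolded family_equiv_def, THEN spec, of "(r, q, n)"] show ?k by simp
  next
    assume k: ?k
    then have "x - y \<in> bwm_ideal r q n" using xy by (simp add: bwm_kernel_iff carrier_free_alg_closed)
    then have "augment q x = augment q y"
      using augment_bwm_ideal[OF q] by (fastforce simp: augment_simps(7))
    then show ?f using k by (simp add: family_equiv_def)
  qed
  also have "\<dots> \<longleftrightarrow> x - y \<in> bwm_ideal r q n"
    using xy by (simp add: bwm_kernel_iff carrier_free_alg_closed)
  finally show ?thesis .
qed

text \<open>
  The relators of \<open>BWM r q n\<close> are zero in the product: in their own component by definition, and
  elsewhere because the augmentation respects them.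
\<close>
lemma bwm_rep_to_product:
  assumes "bwm_params r q"
  shows "bwm_rep product_scale (\<lambda>i. to_product r q n (fg i)) (\<lambda>i. to_product r q n (fe i)) r q n"
proof -
  let ?t = "to_product r q n"
  note h = algebra_homD[OF to_product_hom]
  have q: "q \<noteq> 0" using assms by (simp add: bwm_params_def)
  have gens: "fg i \<in> carrier (free_alg n)" "fe i \<in> carrier (free_alg n)" if "1 \<le> i" "i < n" for i
    using that by (auto intro!: letter_in_free_alg simp: bwm_letters_def)
  have rel: "?t x = ?t y" if "x - y \<in> bwm_relators r q n" "y \<in> carrier (free_alg n)" for x y
  proof -
    have "x - y \<in> carrier (free_alg n)" using that bwm_relators_subset by blast
    then have "x \<in> carrier (free_alg n)" using carrier_free_alg_closed(1)[of "x - y" n y] that by simp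
    then show ?thesis using that bwm_relators_in_ideal by (auto simp: to_product_eq_iff[OF q])
  qed
  note c = gens carrier_free_alg_closed const_in_free_alg
  show ?thesis
  proof
    fix i assume i: "1 \<le> i" "i + 1 < n"
    have "?t (fg i * fg (i+1) * fg i) = ?t (fg (i+1) * fg i * fg (i+1))"
      by (rule rel) (use i in \<open>auto simp: bwm_relators_def intro!: c\<close>)
    then show "?t (fg i) * (?t (fg (i+1)) * ?t (fg i)) = ?t (fg (i+1)) * (?t (fg i) * ?t (fg (i+1)))"
      by (simp only: h mult.assoc)
    have "?t (fg i * fg (i+1) * fe i) = ?t (fe (i+1) * fe i)"
      by (rule rel) (use i in \<open>auto simp: bwm_relators_def intro!: c\<close>)
    then show "?t (fg i) * (?t (fg (i+1)) * ?t (fe i)) = ?t (fe (i+1)) * ?t (fe i)"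
      by (simp only: h mult.assoc)
    have "?t (fg (i+1) * fg i * fe (i+1)) = ?t (fe i * fe (i+1))"
      by (rule rel) (use i in \<open>auto simp: bwm_relators_def intro!: c\<close>)
    then show "?t (fg (i+1)) * (?t (fg i) * ?t (fe (i+1))) = ?t (fe i) * ?t (fe (i+1))"
      by (simp only: h mult.assoc)
  next
    fix i assume i: "1 \<le> i" "i < n"
    have "?t (fg i ^ 2) = ?t (1 + fconst (qhat q) * fg i - fconst (inverse r * qhat q) * fe i)"
      by (rule rel) (use i in \<open>auto simp: bwm_relators_def intro!: c\<close>)
    then show "?t (fg i) * ?t (fg i) =
        1 + product_scale (qhat q) (?t (fg i)) - product_scale (inverse r * qhat q) (?t (fe i))"
      by (simp only: h(1,3,4,7) power2_eq_square) (simp only: h(2))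
    have "?t (fg i * fe i) = ?t (fe i * fg i)"
      by (rule rel) (use i in \<open>auto simp: bwm_relators_def intro!: c\<close>)
    moreover have "?t (fe i * fg i) = ?t (fconst (inverse r) * fe i)"
      by (rule rel) (use i in \<open>auto simp: bwm_relators_def intro!: c\<close>)
    ultimately show "?t (fe i) * ?t (fg i) = product_scale (inverse r) (?t (fe i))"
      "?t (fg i) * ?t (fe i) = product_scale (inverse r) (?t (fe i))"
      by (simp_all only: h(4), simp_all only: h(2))
  next
    fix i j assume i: "1 \<le> i" "i + 1 < j" "j < n"
    have "?t (fg i * fg j) = ?t (fg j * fg i)"
    proof (rule rel)
      have "fg i * fg j - fg j * fg i \<in> {fg i * fg j - fg j * fg i | i j.
          1 \<le> i \<and> i < n \<and> 1 \<le> j \<and> j < n \<and> (i + 1 < j \<or> j + 1 < i)}"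
        using i by (intro CollectI exI[of _ i] exI[of _ j]) simp
      then show "fg i * fg j - fg j * fg i \<in> bwm_relators r q n"
        unfolding bwm_relators_def by (simp only: Un_iff simp_thms)
    qed (use i in \<open>auto intro!: c\<close>)
    then show "?t (fg i) * ?t (fg j) = ?t (fg j) * ?t (fg i)" by (simp only: h)
  qed fact
qed

section \<open>Two-sided absorption and uniqueness\<close>

lemma op_algebra_hom:
  assumes "algebra_hom s s' \<phi>"
  shows "algebra_hom (op_scale s) (op_scale s') (\<lambda>x. to_op (\<phi> (of_op x)))"
  by (simp add: algebra_hom_def of_op_inject[symmetric] op_simps algebra_homD[OF assms])

lemma op_augment_hom: "algebra_hom (op_scale fscale) (*) (\<lambda>x. augment q (of_op x))"
  by (simp add: algebra_hom_def op_simps augment_simps)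

lemma recursion_closed_free_alg:
  assumes "\<And>i. 1 \<le> i \<Longrightarrow> i < n \<Longrightarrow> g i \<in> carrier (free_alg n) \<and> e i \<in> carrier (free_alg n)"
  shows "k < n \<Longrightarrow> recursion_factor fscale g e r q k \<in> carrier (free_alg n)"
    and "k < n \<Longrightarrow> of_op (recursion_factor (op_scale fscale) (\<lambda>i. to_op (g i)) (\<lambda>i. to_op (e i)) r q k) \<in> carrier (free_alg n)"
    and "m \<le> n \<Longrightarrow> antisymmetrizer_rec fscale g e r q m \<in> carrier (free_alg n)"
    and "m \<le> n \<Longrightarrow> of_op (antisymmetrizer_rec (op_scale fscale) (\<lambda>i. to_op (g i)) (\<lambda>i. to_op (e i)) r q m) \<in> carrier (free_alg n)"
proof -
  note c = carrier_free_alg_closed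
  show "k < n \<Longrightarrow> recursion_factor fscale g e r q k \<in> carrier (free_alg n)"
    by (rule recursion_factor_closed[where n = n]) (auto intro!: c simp: assms)
  show "m \<le> n \<Longrightarrow> antisymmetrizer_rec fscale g e r q m \<in> carrier (free_alg n)"
    by (rule antisymmetrizer_rec_closed[where n = n]) (auto intro!: c simp: assms)
  have "recursion_factor (op_scale fscale) (\<lambda>i. to_op (g i)) (\<lambda>i. to_op (e i)) r q k \<in> {x. of_op x \<in> carrier (free_alg n)}"
    if "k < n"
    using that by (intro recursion_factor_closed[where n = n]) (auto intro!: c simp: assms op_simps)
  then show "k < n \<Longrightarrow> of_op (recursion_factor (op_scale fscale) (\<lambda>i. to_op (g i)) (\<lambda>i. to_op (e i)) r q k) \<in> carrier (free_alg n)"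
    by blast
  have "antisymmetrizer_rec (op_scale fscale) (\<lambda>i. to_op (g i)) (\<lambda>i. to_op (e i)) r q m \<in> {x. of_op x \<in> carrier (free_alg n)}"
    if "m \<le> n"
    using that by (intro antisymmetrizer_rec_closed[where n = n]) (auto intro!: c simp: assms op_simps)
  then show "m \<le> n \<Longrightarrow> of_op (antisymmetrizer_rec (op_scale fscale) (\<lambda>i. to_op (g i)) (\<lambda>i. to_op (e i)) r q m) \<in> carrier (free_alg n)"
    by blast
qed

lemma letters_closed:
  "1 \<le> i \<Longrightarrow> i < n \<Longrightarrow> fg i \<in> carrier (free_alg n) \<and> fe i \<in> carrier (free_alg n)"
  by (auto intro!: letter_in_free_alg simp: bwm_letters_def)

locale bwm_eval = complex_algebra scale
  for scale :: "complex \<Rightarrow> 'a::ring_1 \<Rightarrow> 'a" (infixr "\<cdot>" 75) +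
  fixes \<phi> :: "bwm_poly \<Rightarrow> 'a" and r q n
  assumes hom: "algebra_hom fscale scale \<phi>"
    and rep: "bwm_rep scale (\<lambda>i. \<phi> (fg i)) (\<lambda>i. \<phi> (fe i)) r q n"
begin

sublocale bwm_rep scale "\<lambda>i. \<phi> (fg i)" "\<lambda>i. \<phi> (fe i)" r q n by (rule rep)

abbreviation left_absorbs :: "'a \<Rightarrow> nat \<Rightarrow> bool" where
  "left_absorbs a k \<equiv> (\<forall>j. 1 \<le> j \<longrightarrow> j < k \<longrightarrow> \<phi> (fg j) * a = p \<cdot> a)"

lemma absorbs_eval:
  assumes a: "absorbs a n" and y: "y \<in> carrier (free_alg n)"
  shows "a * \<phi> y = augment q y \<cdot> a"
proof -
  note h = algebra_homD[OF hom]
  have word: "a * \<phi> (prod_list (map fletter xs)) = prod_list (map (augment_letter q) xs) \<cdot> a"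
    if "set xs \<subseteq> bwm_letters n" for xs
    using that
  proof (induction xs)
    case (Cons x xs)
    have "a * \<phi> (fletter x) = augment_letter q x \<cdot> a"
    proof (cases x)
      case (LG i)
      then show ?thesis using Cons.prems a by (auto simp: augment_letter_def bwm_letters_def p_def)
    next
      case (LE i)
      then have "1 \<le> i" "i < n" using Cons.prems by (auto simp: bwm_letters_def)
      then show ?thesis using LE absorb_e[of a i] a by (simp add: augment_letter_def)
    qed
    then have "a * (\<phi> (fletter x) * \<phi> (prod_list (map fletter xs))) =
        augment_letter q x \<cdot> (a * \<phi> (prod_list (map fletter xs)))"
      by (simp flip: mult.assoc)
    then show ?case using Cons by (simp add: h(2))
  qed (simp add: h(3))
  have "a * \<phi> (fsubst fletter y) = augment q y \<cdot> a"
    unfolding augment_eq fsubst_def h(8) sum_distrib_left scale_sum_left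
    using y by (intro sum.cong) (auto simp: h(4) word free_alg_def)
  then show ?thesis by (simp only: fsubst_id)
qed

lemma left_absorbs_eval:
  assumes a: "left_absorbs a n" and y: "y \<in> carrier (free_alg n)"
  shows "\<phi> y * a = augment q y \<cdot> a"
proof -
  note h = algebra_homD[OF hom]
  interpret O: bwm_rep "op_scale scale" "\<lambda>i. to_op (\<phi> (fg i))" "\<lambda>i. to_op (\<phi> (fe i))" r q n
    by (rule bwm_rep_opposite)
  have e: "\<phi> (fe i) * a = 0" if "1 \<le> i" "i < n" for i
    using O.absorb_e[of "to_op a" i] that a by (simp add: of_op_inject[symmetric] op_simps O.p_def p_def)
  have word: "\<phi> (prod_list (map fletter xs)) * a = prod_list (map (augment_letter q) xs) \<cdot> a"
    if "set xs \<subseteq> bwm_letters n" for xs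
    using that
  proof (induction xs)
    case (Cons x xs)
    have "\<phi> (fletter x) * a = augment_letter q x \<cdot> a"
      using Cons.prems a e by (cases x) (auto simp: augment_letter_def bwm_letters_def p_def)
    then show ?case using Cons by (simp add: h(2) mult.assoc mult.commute)
  qed (simp add: h(3))
  have "\<phi> (fsubst fletter y) * a = augment q y \<cdot> a"
    unfolding augment_eq fsubst_def h(8) sum_distrib_right scale_sum_left
    using y by (intro sum.cong) (auto simp: h(4) word free_alg_def)
  then show ?thesis by (simp only: fsubst_id)
qed

definition A :: 'a where "A = \<phi> (antisymmetrizer_rec fscale fg fe r q n)"

lemma augment_antisymmetrizer_rec: "augment q (antisymmetrizer_rec fscale fg fe r q m) = 1"
  using antisymmetrizer_rec_trivial[OF params] by (simp add: hom_antisymmetrizer_rec[OF augment_hom])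

lemma A_absorbs: "absorbs A n"
  using antisymmetrizer_rec_absorbs[of n] by (simp add: A_def hom_antisymmetrizer_rec[OF hom])

text \<open>
  The recursion in the opposite algebra yields an element \<open>\<phi> y\<close> that absorbs on the left and has
  augmentation 1. The product of \<open>A\<close> and \<open>\<phi> y\<close> can be evaluated on either side, so
  \<open>A = A * \<phi> y = \<phi> y\<close>.
\<close>
lemma A_left_absorbs: "left_absorbs A n"
proof -
  interpret O: bwm_rep "op_scale scale" "\<lambda>i. to_op (\<phi> (fg i))" "\<lambda>i. to_op (\<phi> (fe i))" r q n
    by (rule bwm_rep_opposite)
  define B where "B = antisymmetrizer_rec (op_scale scale) (\<lambda>i. to_op (\<phi> (fg i))) (\<lambda>i. to_op (\<phi> (fe i))) r q n"
  define y where "y = of_op (antisymmetrizer_rec (op_scale fscale) (\<lambda>i. to_op (fg i)) (\<lambda>i. to_op (fe i)) r q n)"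
  have y: "y \<in> carrier (free_alg n)" unfolding y_def by (intro recursion_closed_free_alg letters_closed) auto
  have aug: "augment q y = 1"
    using antisymmetrizer_rec_trivial[OF params] by (simp add: y_def hom_antisymmetrizer_rec[OF op_augment_hom] op_simps)
  have "to_op (\<phi> y) = B"
    unfolding y_def B_def by (subst hom_antisymmetrizer_rec[OF op_algebra_hom[OF hom]]) (simp add: op_simps)
  then have B: "of_op B = \<phi> y" by (metis op_simps(7))
  have left: "left_absorbs (\<phi> y) n"
  proof (intro allI impI)
    fix i assume "1 \<le> i" "i < n"
    then have "B * to_op (\<phi> (fg i)) = op_scale scale O.p B"
      using O.antisymmetrizer_rec_absorbs[of n] by (simp add: B_def)
    then show "\<phi> (fg i) * \<phi> y = p \<cdot> \<phi> y"
      by (simp add: of_op_inject[symmetric] op_simps B O.p_def p_def)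
  qed
  have "A = A * \<phi> y" using absorbs_eval[OF A_absorbs y] aug by simp
  also have "\<dots> = \<phi> y"
    using left_absorbs_eval[OF left, of "antisymmetrizer_rec fscale fg fe r q n"] recursion_closed_free_alg(3)[OF letters_closed]
    by (simp add: A_def augment_antisymmetrizer_rec)
  finally show ?thesis using left by simp
qed

lemma antisymmetrizer_rec_closed_free_alg: "antisymmetrizer_rec fscale fg fe r q n \<in> carrier (free_alg n)"
  by (intro recursion_closed_free_alg letters_closed) auto

text \<open>
  The same evaluation of a product from both sides identifies \<open>A\<close> with every element of
  augmentation 1 that absorbs on one side.
\<close>
lemma A_unique:
  assumes "y \<in> carrier (free_alg n)" "augment q y = 1" "absorbs (\<phi> y) n \<or> left_absorbs (\<phi> y) n"
  shows "\<phi> y = A"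
  using assms(3)
proof
  assume "absorbs (\<phi> y) n"
  then have "\<phi> y * A = \<phi> y"
    unfolding A_def by (subst absorbs_eval) (simp_all add: antisymmetrizer_rec_closed_free_alg augment_antisymmetrizer_rec)
  moreover have "\<phi> y * A = A" using left_absorbs_eval[OF A_left_absorbs] assms by simp
  ultimately show ?thesis by simp
next
  assume "left_absorbs (\<phi> y) n"
  then have "A * \<phi> y = \<phi> y"
    unfolding A_def by (subst left_absorbs_eval) (simp_all add: antisymmetrizer_rec_closed_free_alg augment_antisymmetrizer_rec)
  moreover have "A * \<phi> y = A" using absorbs_eval[OF A_absorbs] assms by simp
  ultimately show ?thesis by simp
qed

end

lemma bwm_eval_to_product: "bwm_params r q \<Longrightarrow> bwm_eval product_scale (to_product r q n) r q n"
  by (simp add: bwm_eval_def bwm_eval_axioms_def bwm_product.complex_algebra_axioms to_product_hom bwm_rep_to_product)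

section \<open>The elements of the recursion as classes of polynomials\<close>

context complex_algebra begin

lemma staircase_sum:
  "staircase scale g p k = (\<Sum>i=0..k. (p ^ i) \<cdot> prod_list (map g (rev [k+1-i..<k+1])))"
proof (induction k)
  case (Suc k)
  have *: "[Suc (Suc k) - Suc i..<Suc (Suc k)] = [k+1-i..<k+1] @ [Suc k]" if "i \<le> k" for i
    using that by simp
  have "(\<Sum>i=0..Suc k. (p ^ i) \<cdot> prod_list (map g (rev [Suc k+1-i..<Suc k+1]))) =
      1 + (\<Sum>i=0..k. (p ^ Suc i) \<cdot> prod_list (map g (rev [Suc (Suc k) - Suc i..<Suc (Suc k)])))"
    by (subst sum.atLeast0_atMost_Suc_shift) (simp del: upt_Suc)
  also have "(\<Sum>i=0..k. (p ^ Suc i) \<cdot> prod_list (map g (rev [Suc (Suc k) - Suc i..<Suc (Suc k)]))) =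
      (\<Sum>i=0..k. p \<cdot> (g (Suc k) * (p ^ i) \<cdot> prod_list (map g (rev [k+1-i..<k+1]))))"
    by (intro sum.cong refl) (subst *, auto simp del: upt_Suc)
  also have "\<dots> = p \<cdot> (g (Suc k) * staircase scale g p k)"
    unfolding Suc by (simp only: sum_distrib_left scale_sum_right)
  finally show ?case by (simp del: upt_Suc)
qed simp

lemma recursion_factor_sum:
  "recursion_factor scale g e r q k =
    (\<Sum>i=0..k. ((- q) powi (- int i)) \<cdot> prod_list (map g (rev [k+1-i..<k+1])))
    - ab_coeff r q k \<cdot> (\<Sum>i=1..k. (q powi (2 * int i - 2 * int k - 1)) \<cdot>
        (prod_list (map e (rev [i..<k+1])) *
         (\<Sum>j=0..i-1. ((- q) powi (- int j)) \<cdot> prod_list (map g (rev [i-j..<i])))))"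
proof -
  have *: "(- q) powi (- int j) = (- inverse q) ^ j" for j
    by (simp add: power_int_minus power_inverse[symmetric])
  have "staircase scale g (- inverse q) (i-1) =
      (\<Sum>j=0..i-1. ((- inverse q) ^ j) \<cdot> prod_list (map g (rev [i-j..<i])))" if "1 \<le> i" for i
    using that by (simp add: staircase_sum del: upt_Suc)
  then show ?thesis
    unfolding recursion_factor_def descend_def *
    by (subst staircase_sum[of g "- inverse q" k]) (simp del: upt_Suc)
qed

lemma complex_algebra_opposite: "complex_algebra (op_scale scale)"
  by unfold_locales (simp_all add: of_op_inject[symmetric] op_simps scale_left_distrib scale_right_distrib)

end

interpretation free_alg: complex_algebra fscale
proof
  fix c and x y :: bwm_poly
  show "x * (fconst c * y) = fconst c * (x * y)" by (metis fconst_commute mult.assoc)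
qed (simp_all add: algebra_simps fconst_add fconst_mult fconst_1)

interpretation op_free_alg: complex_algebra "op_scale fscale"
  by (rule free_alg.complex_algebra_opposite)

lemma of_op_sum: "of_op (sum f S) = (\<Sum>x\<in>S. of_op (f x))"
  by (induction S rule: infinite_finite_induct) (simp_all add: op_simps)

lemma of_op_prod_list: "of_op (prod_list (map (\<lambda>i. to_op (f i)) xs)) = prod_list (map f (rev xs))"
  by (induction xs) (simp_all add: op_simps)

lemma recursion_factor_op_sum:
  "of_op (recursion_factor (op_scale fscale) (\<lambda>i. to_op (g i)) (\<lambda>i. to_op (e i)) r q k) =
    (\<Sum>i=0..k. fconst ((- q) powi (- int i)) * prod_list (map g [k+1-i..<k+1]))
    - fconst (ab_coeff r q k) * (\<Sum>i=1..k. fconst (q powi (2 * int i - 2 * int k - 1)) *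
        ((\<Sum>j=0..i-1. fconst ((- q) powi (- int j)) * prod_list (map g [i-j..<i])) *
         prod_list (map e [i..<k+1])))"
  by (simp add: op_free_alg.recursion_factor_sum op_simps of_op_sum of_op_prod_list del: upt_Suc)

text \<open>
  A rule-based translation: the lemmas below follow the syntax of an element of \<open>BWM r q n\<close> and
  build a polynomial in its class.
\<close>
definition represents :: "complex \<Rightarrow> complex \<Rightarrow> nat \<Rightarrow> bwm_poly set \<Rightarrow> bwm_poly \<Rightarrow> bool" where
  "represents r q n x p \<longleftrightarrow> p \<in> carrier (free_alg n) \<and> x = bwm_class r q n p"

context
  fixes r q :: complex and n :: nat
begin

interpretation R: ring "BWM r q n" by (rule ring_BWM)

lemma represents_mult:
  "represents r q n x p \<Longrightarrow> represents r q n y p' \<Longrightarrow> represents r q n (x \<otimes>\<^bsub>BWM r q n\<^esub> y) (p * p')"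
  using ring_hom_mult[OF bwm_class_ring_hom[of r q n], of p p'] by (auto simp: represents_def free_alg_simps carrier_free_alg_closed)

lemma represents_add:
  "represents r q n x p \<Longrightarrow> represents r q n y p' \<Longrightarrow> represents r q n (x \<oplus>\<^bsub>BWM r q n\<^esub> y) (p + p')"
  using ring_hom_add[OF bwm_class_ring_hom[of r q n], of p p'] by (auto simp: represents_def free_alg_simps carrier_free_alg_closed)

lemma represents_one: "represents r q n \<one>\<^bsub>BWM r q n\<^esub> 1"
  using ring_hom_one[OF bwm_class_ring_hom] by (simp add: represents_def free_alg_simps)

lemma represents_zero: "represents r q n \<zero>\<^bsub>BWM r q n\<^esub> 0"
  using ring_hom_zero[OF bwm_class_ring_hom ring_free_alg ring_BWM] by (simp add: represents_def free_alg_simps)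

lemma represents_carrier: "represents r q n x p \<Longrightarrow> x \<in> carrier (BWM r q n)"
  by (auto simp: represents_def carrier_BWM)

lemma represents_smult:
  "represents r q n x p \<Longrightarrow> represents r q n (bwm_smult r q n c x) (fconst c * p)"
  unfolding bwm_smult_def by (intro represents_mult) (auto simp: represents_def)

lemma represents_minus:
  assumes "represents r q n x p" "represents r q n y p'"
  shows "represents r q n (x \<ominus>\<^bsub>BWM r q n\<^esub> y) (p - p')"
proof -
  have y': "represents r q n (bwm_class r q n (- p')) (- p')"
    using assms by (auto simp: represents_def carrier_free_alg_closed)
  have "bwm_class r q n (- p') \<oplus>\<^bsub>BWM r q n\<^esub> y = \<zero>\<^bsub>BWM r q n\<^esub>"
    using represents_add[OF y' assms(2)] represents_zero by (simp add: represents_def)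
  then have "\<ominus>\<^bsub>BWM r q n\<^esub> y = bwm_class r q n (- p')"
    using assms(2) y' by (intro R.minus_equality) (auto intro: represents_carrier)
  then show ?thesis
    using represents_add[OF assms(1) y'] by (simp add: a_minus_def)
qed

lemma represents_finsum:
  assumes "finite S" "\<And>j. j \<in> S \<Longrightarrow> represents r q n (F j) (f j)"
  shows "represents r q n (\<Oplus>\<^bsub>BWM r q n\<^esub>j\<in>S. F j) (\<Sum>j\<in>S. f j)"
  using assms
proof (induction S rule: finite_induct)
  case (insert j S)
  then have "(\<Oplus>\<^bsub>BWM r q n\<^esub>j\<in>insert j S. F j) = F j \<oplus>\<^bsub>BWM r q n\<^esub> (\<Oplus>\<^bsub>BWM r q n\<^esub>j\<in>S. F j)"
    by (intro R.finsum_insert) (auto intro: represents_carrier)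
  then show ?case using insert represents_add[of "F j" "f j"] by simp
qed (simp add: represents_zero)

lemma represents_gprod:
  "set xs \<subseteq> {1..<n} \<Longrightarrow> represents r q n (gprod r q n xs) (prod_list (map fg xs))"
  and represents_eprod:
  "set xs \<subseteq> {1..<n} \<Longrightarrow> represents r q n (eprod r q n xs) (prod_list (map fe xs))"
  using letters_closed
  by (induction xs)
    (auto simp: gprod_def eprod_def bwm_g_def bwm_e_def represents_one
      intro!: represents_mult simp: represents_def[of r q n "bwm_class r q n _"])

lemmas represents_intros = represents_minus represents_smult represents_finsum represents_mult
  represents_gprod represents_eprod

end

lemma map_diff_rev_upt:
  assumes "b \<le> n" shows "map (\<lambda>i. n - i) (rev [a..<b]) = [n+1-b..<n+1-a]"
  using assms by (intro nth_equalityI) (auto simp: rev_nth)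

lemma map_flip:
  assumes "b \<le> n" shows "map (\<lambda>i. f (n - i)) (rev [a..<b]) = map f [n+1-b..<n+1-a]"
    "map (\<lambda>i. f (n - i)) [a..<b] = map f (rev [n+1-b..<n+1-a])"
proof -
  show 1: "map (\<lambda>i. f (n - i)) (rev [a..<b]) = map f [n+1-b..<n+1-a]" for f :: "nat \<Rightarrow> 'a"
    by (simp only: map_diff_rev_upt[OF assms, symmetric] map_map comp_def)
  show "map (\<lambda>i. f (n - i)) [a..<b] = map f (rev [n+1-b..<n+1-a])"
    using arg_cong[OF 1[of f], of rev] by (simp add: rev_map)
qed

lemma represents_b_minus_k1:
  "represents r q (Suc k) (b_minus_k1 r q (Suc k) k) (recursion_factor fscale fg fe r q k)"
  unfolding b_minus_k1_def d_minus_def free_alg.recursion_factor_sum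
  by (intro represents_intros) auto

lemma represents_b_minus_1k:
  fixes k defines "n \<equiv> Suc k"
  shows "represents r q n (b_minus_1k r q n k) (recursion_factor fscale (\<lambda>i. fg (n-i)) (\<lambda>i. fe (n-i)) r q k)"
proof -
  have "recursion_factor fscale (\<lambda>i. fg (n-i)) (\<lambda>i. fe (n-i)) r q k =
    (\<Sum>i=0..k. fconst ((- q) powi (- int i)) * prod_list (map fg [1..<i+1]))
    - fconst (ab_coeff r q k) * (\<Sum>i=1..k. fconst (q powi (2 * int i - 2 * int k - 1)) *
        (prod_list (map fe [1..<k+1-i+1]) *
         (\<Sum>j=0..i-1. fconst ((- q) powi (- int j)) * prod_list (map fg [k+1+1-i..<k+1-i+j+1]))))"
    unfolding free_alg.recursion_factor_sum
    by (intro arg_cong2[where f = "(-)"] arg_cong2[where f = "(*)"] sum.cong refl arg_cong[where f = prod_list];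
        subst map_flip; auto simp: n_def Suc_diff_le simp del: upt_Suc intro!: arg_cong2[where f = upt])
  moreover have "represents r q n (b_minus_1k r q n k) \<dots>"
    unfolding b_minus_1k_def d_minus'_def by (intro represents_intros) (auto simp: n_def)
  ultimately show ?thesis by simp
qed

lemma represents_a_minus_k1:
  "represents r q (Suc k) (a_minus_k1 r q (Suc k) k)
    (of_op (recursion_factor (op_scale fscale) (\<lambda>i. to_op (fg i)) (\<lambda>i. to_op (fe i)) r q k))"
  unfolding a_minus_k1_def dbar_minus_def recursion_factor_op_sum
  by (intro represents_intros) auto

lemma represents_a_minus_1k:
  fixes k defines "n \<equiv> Suc k"
  shows "represents r q n (a_minus_1k r q n k)
    (of_op (recursion_factor (op_scale fscale) (\<lambda>i. to_op (fg (n-i))) (\<lambda>i. to_op (fe (n-i))) r q k))"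
proof -
  have "of_op (recursion_factor (op_scale fscale) (\<lambda>i. to_op (fg (n-i))) (\<lambda>i. to_op (fe (n-i))) r q k) =
    (\<Sum>i=0..k. fconst ((- q) powi (- int i)) * prod_list (map fg (rev [1..<i+1])))
    - fconst (ab_coeff r q k) * (\<Sum>i=1..k. fconst (q powi (2 * int i - 2 * int k - 1)) *
        ((\<Sum>j=0..i-1. fconst ((- q) powi (- int j)) * prod_list (map fg (rev [k+1+1-i..<k+1-i+j+1])))
         * prod_list (map fe (rev [1..<k+1-i+1]))))"
    unfolding recursion_factor_op_sum
    by (intro arg_cong2[where f = "(-)"] arg_cong2[where f = "(*)"] sum.cong refl arg_cong[where f = prod_list];
        subst map_flip; auto simp: n_def Suc_diff_le simp del: upt_Suc intro!: arg_cong2[where f = upt])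
  moreover have "represents r q n (a_minus_1k r q n k) \<dots>"
    unfolding a_minus_1k_def dbar_minus'_def by (intro represents_intros) (auto simp: n_def)
  ultimately show ?thesis by simp
qed

section \<open>The recursion for the antisymmetrizer\<close>

lemma bwm_class_eq_iff:
  "bwm_class r q n x = bwm_class r q n y \<longleftrightarrow> x - y \<in> bwm_ideal r q n"
proof -
  interpret I: ideal "bwm_ideal r q n" "free_alg n" by (rule ideal_bwm_ideal)
  have add: "a + b \<in> bwm_ideal r q n" if "a \<in> bwm_ideal r q n" "b \<in> bwm_ideal r q n" for a b
    using additive_subgroup.a_closed[OF I.is_additive_subgroup that] by (simp add: free_alg_simps)
  have zero: "0 \<in> bwm_ideal r q n"
    using additive_subgroup.zero_closed[OF I.is_additive_subgroup] by (simp add: free_alg_simps)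
  have uminus: "- a \<in> bwm_ideal r q n" if "a \<in> bwm_ideal r q n" for a
    using I.I_l_closed[OF that, of "- 1"] carrier_free_alg_closed(3)[OF zero_one_in_free_alg(2,2)]
    by (simp add: free_alg_simps)
  have mem: "z \<in> bwm_class r q n y \<longleftrightarrow> z - y \<in> bwm_ideal r q n" for y z
    by (force simp: bwm_class_def a_r_coset_def' free_alg_simps)
  show ?thesis
  proof
    assume "bwm_class r q n x = bwm_class r q n y"
    moreover have "x \<in> bwm_class r q n x" by (simp add: mem zero)
    ultimately show "x - y \<in> bwm_ideal r q n" by (simp add: mem)
  next
    assume d: "x - y \<in> bwm_ideal r q n"
    have "z - x \<in> bwm_ideal r q n \<longleftrightarrow> z - y \<in> bwm_ideal r q n" for z
      using add[OF _ d, of "z - x"] add[OF _ uminus[OF d], of "z - y"] by auto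
    then show "bwm_class r q n x = bwm_class r q n y" by (auto simp: mem)
  qed
qed

text \<open>
  One-sided absorption and augmentation 1 suffice, because both imply equality with \<open>A\<close>. The
  augmentation also shows that \<open>x\<close> is not zero, and any nonzero idempotent that absorbs on the
  right has augmentation 1, since it equals its own square.
\<close>
lemma antisymmetrizer_characterization:
  assumes params: "bwm_params r q" and x: "represents r q n x y" and aug: "augment q y = 1"
    and abs: "(\<forall>i. 1 \<le> i \<longrightarrow> i < n \<longrightarrow> to_product r q n y * to_product r q n (fg i) = product_scale (- inverse q) (to_product r q n y)) \<or>
      (\<forall>i. 1 \<le> i \<longrightarrow> i < n \<longrightarrow> to_product r q n (fg i) * to_product r q n y = product_scale (- inverse q) (to_product r q n y))"
  shows "x = antisymmetrizer r q n"
proof -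
  let ?t = "to_product r q n" and ?B = "BWM r q n"
  interpret bwm_eval product_scale ?t r q n by (rule bwm_eval_to_product[OF params])
  note h = algebra_homD[OF hom]
  have y: "y \<in> carrier (free_alg n)" and xy: "x = bwm_class r q n y"
    using x by (auto simp: represents_def)
  have class_eq: "u = v \<longleftrightarrow> ?t u' = ?t v'" if "represents r q n u u'" "represents r q n v v'" for u v u' v'
  proof -
    have "u = v \<longleftrightarrow> u' - v' \<in> bwm_ideal r q n"
      using that by (simp add: represents_def bwm_class_eq_iff)
    then show ?thesis using that to_product_eq_iff[OF q0, of u' n v' r] by (simp add: represents_def)
  qed
  have tA: "?t y = A" using y aug abs by (intro A_unique) (auto simp: p_def)
  have gen: "represents r q n (bwm_g r q n i) (fg i)" if "i \<in> {1..n-1}" for i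
    using that letters_closed[of i n] by (auto simp: represents_def bwm_g_def)
  have "antisymmetrizer r q n = x"
    unfolding antisymmetrizer_def
  proof (rule the_equality, intro conjI ballI)
    show "x \<in> carrier ?B" using x by (rule represents_carrier)
    show "x \<noteq> \<zero>\<^bsub>?B\<^esub>"
    proof
      assume "x = \<zero>\<^bsub>?B\<^esub>"
      then have "y \<in> bwm_ideal r q n"
        using class_eq[OF x represents_zero] to_product_eq_iff[OF q0 y, of 0 r] by simp
      then show False using augment_bwm_ideal[OF q0] aug by fastforce
    qed
    have "?t (y * y) = ?t y"
      using absorbs_eval[OF A_absorbs y] aug by (simp add: h(2) tA)
    then show "x \<otimes>\<^bsub>?B\<^esub> x = x" using class_eq[OF represents_mult[OF x x] x] by simp
    fix i assume i: "i \<in> {1..n-1}"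
    then have "A * ?t (fg i) = product_scale p A" using A_absorbs by auto
    then have "?t (y * fg i) = ?t (fconst (- inverse q) * y)"
      by (simp only: h(4), simp only: h(2) tA p_def)
    then show "x \<otimes>\<^bsub>?B\<^esub> bwm_g r q n i = bwm_smult r q n (- inverse q) x"
      using class_eq[OF represents_mult[OF x gen[OF i]] represents_smult[OF x]] by simp
  next
    fix z assume z: "z \<in> carrier ?B \<and> z \<noteq> \<zero>\<^bsub>?B\<^esub> \<and> z \<otimes>\<^bsub>?B\<^esub> z = z \<and>
      (\<forall>i\<in>{1..n-1}. z \<otimes>\<^bsub>?B\<^esub> bwm_g r q n i = bwm_smult r q n (- inverse q) z)"
    then obtain w where w: "represents r q n z w" by (auto simp: carrier_BWM represents_def)
    then have w': "w \<in> carrier (free_alg n)" by (simp add: represents_def)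
    have absw: "absorbs (?t w) n"
    proof (intro allI impI)
      fix i assume "1 \<le> i" "i < n"
      then have i: "i \<in> {1..n-1}" by auto
      then have "?t (w * fg i) = ?t (fconst (- inverse q) * w)"
        using z class_eq[OF represents_mult[OF w gen[OF i]] represents_smult[OF w]] by blast
      then show "?t w * ?t (fg i) = product_scale p (?t w)"
        by (simp only: h(4), simp only: h(2) p_def)
    qed
    have "?t w * ?t w = ?t w" "?t w \<noteq> 0"
      using z class_eq[OF represents_mult[OF w w] w] class_eq[OF w represents_zero] by (auto simp: h(2,5))
    then have "product_scale (augment q w - 1) (?t w) = 0"
      using absorbs_eval[OF absw w'] by (simp add: bwm_product.scale_left_diff_distrib)
    then have "augment q w = 1"
      using scale_cancel[of "augment q w - 1" "?t w" 0] \<open>?t w \<noteq> 0\<close> by auto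
    then have "?t w = A" using absw w' by (intro A_unique) auto
    then show "z = x" using class_eq[OF w x] tA by simp
  qed
  then show ?thesis by simp
qed

text \<open>
  Replacing \<open>q\<close> by \<open>- 1 / q\<close> changes neither \<open>qhat q\<close> nor the relations, so both sides are the
  same description in the same ring.
\<close>
lemma symmetrizer_neg_inverse: "symmetrizer r (- inverse q) n = antisymmetrizer r q n"
  by (simp add: symmetrizer_def antisymmetrizer_def BWM_neg_inverse bwm_g_def bwm_smult_def
      bwm_class_def bwm_ideal_neg_inverse)

lemma antisymmetrizer_represents:
  assumes "bwm_params r q"
  shows "represents r q n (antisymmetrizer r q n) (antisymmetrizer_rec fscale fg fe r q n)"
proof -
  interpret bwm_eval product_scale "to_product r q n" r q n by (rule bwm_eval_to_product[OF assms])
  have "represents r q n (bwm_class r q n (antisymmetrizer_rec fscale fg fe r q n)) (antisymmetrizer_rec fscale fg fe r q n)"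
    by (simp add: represents_def antisymmetrizer_rec_closed_free_alg)
  then show ?thesis
    using antisymmetrizer_characterization[OF assms _ augment_antisymmetrizer_rec] A_absorbs
    by (fastforce simp: A_def p_def)
qed

abbreviation fshift :: "bwm_poly \<Rightarrow> bwm_poly" where
  "fshift \<equiv> fsubst (\<lambda>x. fletter (shift_letter x))"

lemma fshift_closed: "y \<in> carrier (free_alg k) \<Longrightarrow> fshift y \<in> carrier (free_alg (Suc k))"
  by (rule fsubst_closed[of k]) (auto intro!: letter_in_free_alg simp: bwm_letters_def)

lemma (in bwm_eval) bwm_eval_mono: "m \<le> n \<Longrightarrow> bwm_eval scale \<phi> r q m"
  by (simp add: bwm_eval_def bwm_eval_axioms_def complex_algebra_axioms hom bwm_rep_mono)

lemma (in bwm_eval) bwm_eval_shift: "bwm_eval scale (\<lambda>y. \<phi> (fshift y)) r q (n-1)"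
proof -
  have "algebra_hom fscale scale (\<lambda>y. \<phi> (fshift y))"
    unfolding algebra_hom_def
    by (simp only: fsubst_add fsubst_mult fsubst_1 fsubst_fconst algebra_homD(1,3,4)[OF hom])
      (simp only: algebra_homD(2)[OF hom] simp_thms)
  then show ?thesis
    using bwm_rep_shift by (simp add: bwm_eval_def bwm_eval_axioms_def complex_algebra_axioms)
qed

theorem mainTheorem3:
  fixes q r :: complex and n :: nat
  assumes "bwm_params r q" and "n \<ge> 3"
  shows
    "let A = antisymmetrizer r q n;
         B = antisymmetrizer r q (n-1);
         c = q ^ (n-1) / qnum q (int n)
     in A = bwm_gamma r q n (symmetrizer r (- inverse q) n)
      \<and> A = bwm_smult r q n c (bwm_embed r q n B \<otimes>\<^bsub>BWM r q n\<^esub> b_minus_k1 r q n (n-1))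
      \<and> A = bwm_smult r q n c (bwm_shift r q n B \<otimes>\<^bsub>BWM r q n\<^esub> b_minus_1k r q n (n-1))
      \<and> A = bwm_smult r q n c (a_minus_k1 r q n (n-1) \<otimes>\<^bsub>BWM r q n\<^esub> bwm_embed r q n B)
      \<and> A = bwm_smult r q n c (a_minus_1k r q n (n-1) \<otimes>\<^bsub>BWM r q n\<^esub> bwm_shift r q n B)"
proof -
  obtain k where n: "n = Suc k" using assms(2) by (cases n) auto
  note params = assms(1)
  let ?t = "to_product r q n" and ?c = "q ^ k / qnum q (int (Suc k))"
  let ?y = "antisymmetrizer_rec fscale fg fe r q k" and ?B = "antisymmetrizer r q k"
  interpret E: bwm_eval product_scale ?t r q n by (rule bwm_eval_to_product[OF params])
  interpret K: bwm_eval product_scale ?t r q k by (rule E.bwm_eval_mono) (simp add: n)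
  interpret S: bwm_eval product_scale "\<lambda>y. ?t (fshift y)" r q k
    using E.bwm_eval_shift by (simp add: n)
  interpret F: bwm_rep product_scale "\<lambda>i. ?t (fg (n-i))" "\<lambda>i. ?t (fe (n-i))" r q n
    by (rule E.bwm_rep_flip)
  interpret O: bwm_rep "op_scale product_scale" "\<lambda>i. to_op (?t (fg i))" "\<lambda>i. to_op (?t (fe i))" r q n
    by (rule E.bwm_rep_opposite)
  interpret OF: bwm_rep "op_scale product_scale" "\<lambda>i. to_op (?t (fg (n-i)))" "\<lambda>i. to_op (?t (fe (n-i)))" r q n
    by (rule F.bwm_rep_opposite)
  note h = algebra_homD[OF E.hom]
  have p: "O.p = - inverse q" "OF.p = - inverse q" "F.p = - inverse q" "E.p = - inverse q"
      "K.p = - inverse q" "S.p = - inverse q"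
    by (simp_all only: O.p_def OF.p_def F.p_def E.p_def K.p_def S.p_def)
  have y: "?y \<in> carrier (free_alg k)" by (rule K.antisymmetrizer_rec_closed_free_alg)
  have y_n: "?y \<in> carrier (free_alg n)" by (intro recursion_closed_free_alg letters_closed) (auto simp: n)
  have embed: "represents r q n (bwm_embed r q n ?B) ?y"
    using antisymmetrizer_represents[OF params, of k] bwm_embed_class[of k n ?y r q] y
      y_n
    by (simp add: represents_def n)
  have shift: "represents r q n (bwm_shift r q n ?B) (fshift ?y)"
    using antisymmetrizer_represents[OF params, of k] bwm_shift_class[OF y, of r q] fshift_closed[OF y]
    by (simp add: represents_def n)
  have aug_y: "augment q ?y = 1" by (rule K.augment_antisymmetrizer_rec)
  have aug_shift: "augment q (fshift ?y) = 1"
  proof -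
    have "algebra_hom fscale (*) (\<lambda>y. augment q (fshift y))"
      unfolding algebra_hom_def
      by (simp add: augment_simps fsubst_add fsubst_mult)
    from hom_antisymmetrizer_rec[OF this, of fg fe r q k] show ?thesis
      using antisymmetrizer_rec_trivial[OF params, of k] by simp
  qed
  have rf: "?c * augment q (recursion_factor fscale (\<lambda>i. fg (f i)) (\<lambda>i. fe (f i)) r q k) = 1"
    "?c * augment q (of_op (recursion_factor (op_scale fscale) (\<lambda>i. to_op (fg (f i))) (\<lambda>i. to_op (fe (f i))) r q k)) = 1"
    for f
    using recursion_factor_trivial[OF params, of k]
    by (simp_all only: hom_recursion_factor[OF augment_hom] hom_recursion_factor[OF op_augment_hom]
        op_simps augment_gens)
  \<comment> \<open>\<open>f\<close> is the identity or the flip \<open>i \<mapsto> n - i\<close>.\<close>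
  have right: "x = antisymmetrizer r q n"
    if x: "represents r q n x (fconst ?c * (u * recursion_factor fscale (\<lambda>i. fg (f i)) (\<lambda>i. fe (f i)) r q k))"
      and u: "augment q u = 1"
      and abs: "\<forall>m. 1 \<le> m \<longrightarrow> m < k + 1 \<longrightarrow>
        ?t u * recursion_factor product_scale (\<lambda>i. ?t (fg (f i))) (\<lambda>i. ?t (fe (f i))) r q k * ?t (fg (f m)) =
        product_scale (- inverse q) (?t u * recursion_factor product_scale (\<lambda>i. ?t (fg (f i))) (\<lambda>i. ?t (fe (f i))) r q k)"
      and f: "\<forall>i. 1 \<le> i \<longrightarrow> i < n \<longrightarrow> (\<exists>m. 1 \<le> m \<and> m < k + 1 \<and> i = f m)"
    for x u f
  proof (rule antisymmetrizer_characterization[OF params x])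
    let ?R = "recursion_factor fscale (\<lambda>i. fg (f i)) (\<lambda>i. fe (f i)) r q k"
    show "augment q (fconst ?c * (u * ?R)) = 1"
      using rf(1)[of f] u by (simp add: augment_simps)
    have "?t (fconst ?c * (u * ?R)) = product_scale ?c (?t (u * ?R))" by (rule h(4))
    then have eq: "?t (fconst ?c * (u * ?R)) = product_scale ?c
        (?t u * recursion_factor product_scale (\<lambda>i. ?t (fg (f i))) (\<lambda>i. ?t (fe (f i))) r q k)"
      by (simp only: h(2) hom_recursion_factor[OF E.hom])
    have "?t (fconst ?c * (u * ?R)) * ?t (fg i) = product_scale (- inverse q) (?t (fconst ?c * (u * ?R)))"
      if "1 \<le> i" "i < n" for i
      using that f abs unfolding eq by (auto simp: mult.commute)
    then show "(\<forall>i. 1 \<le> i \<longrightarrow> i < n \<longrightarrow> ?t (fconst ?c * (u * ?R)) * ?t (fg i) =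
          product_scale (- inverse q) (?t (fconst ?c * (u * ?R)))) \<or>
        (\<forall>i. 1 \<le> i \<longrightarrow> i < n \<longrightarrow> ?t (fg i) * ?t (fconst ?c * (u * ?R)) =
          product_scale (- inverse q) (?t (fconst ?c * (u * ?R))))" by blast
  qed
  have left: "x = antisymmetrizer r q n"
    if x: "represents r q n x (fconst ?c *
        (of_op (recursion_factor (op_scale fscale) (\<lambda>i. to_op (fg (f i))) (\<lambda>i. to_op (fe (f i))) r q k) * u))"
      and u: "augment q u = 1"
      and abs: "\<forall>m. 1 \<le> m \<longrightarrow> m < k + 1 \<longrightarrow>
        to_op (?t u) * recursion_factor (op_scale product_scale) (\<lambda>i. to_op (?t (fg (f i)))) (\<lambda>i. to_op (?t (fe (f i)))) r q k
          * to_op (?t (fg (f m))) =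
        op_scale product_scale (- inverse q) (to_op (?t u) *
          recursion_factor (op_scale product_scale) (\<lambda>i. to_op (?t (fg (f i)))) (\<lambda>i. to_op (?t (fe (f i)))) r q k)"
      and f: "\<forall>i. 1 \<le> i \<longrightarrow> i < n \<longrightarrow> (\<exists>m. 1 \<le> m \<and> m < k + 1 \<and> i = f m)"
    for x u f
  proof (rule antisymmetrizer_characterization[OF params x])
    let ?R = "of_op (recursion_factor (op_scale fscale) (\<lambda>i. to_op (fg (f i))) (\<lambda>i. to_op (fe (f i))) r q k)"
    let ?R' = "recursion_factor (op_scale product_scale) (\<lambda>i. to_op (?t (fg (f i)))) (\<lambda>i. to_op (?t (fe (f i)))) r q k"
    show "augment q (fconst ?c * (?R * u)) = 1"
      using rf(2)[of f] u by (simp add: augment_simps)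
    have R: "to_op (?t ?R) = ?R'"
      by (subst hom_recursion_factor[OF op_algebra_hom[OF E.hom]]) (simp only: op_simps)
    have "?t (fconst ?c * (?R * u)) = product_scale ?c (?t (?R * u))" by (rule h(4))
    then have eq: "?t (fconst ?c * (?R * u)) = product_scale ?c (?t ?R * ?t u)" by (simp only: h(2))
    have "?t (fg i) * (?t ?R * ?t u) = product_scale (- inverse q) (?t ?R * ?t u)"
      if "1 \<le> i" "i < n" for i
      using that f abs unfolding R[symmetric] by (auto simp: of_op_inject[symmetric] op_simps)
    then have "?t (fg i) * ?t (fconst ?c * (?R * u)) = product_scale (- inverse q) (?t (fconst ?c * (?R * u)))"
      if "1 \<le> i" "i < n" for i
      using that unfolding eq by (simp add: mult.commute)
    then show "(\<forall>i. 1 \<le> i \<longrightarrow> i < n \<longrightarrow> ?t (fconst ?c * (?R * u)) * ?t (fg i) =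
          product_scale (- inverse q) (?t (fconst ?c * (?R * u)))) \<or>
        (\<forall>i. 1 \<le> i \<longrightarrow> i < n \<longrightarrow> ?t (fg i) * ?t (fconst ?c * (?R * u)) =
          product_scale (- inverse q) (?t (fconst ?c * (?R * u))))" by blast
  qed
  have kn: "k < n" by (simp add: n)
  have id: "\<forall>i. 1 \<le> i \<longrightarrow> i < n \<longrightarrow> (\<exists>m. 1 \<le> m \<and> m < k + 1 \<and> i = m)" by (simp add: n)
  have flip: "\<forall>i. 1 \<le> i \<longrightarrow> i < n \<longrightarrow> (\<exists>m. 1 \<le> m \<and> m < k + 1 \<and> i = n - m)"
  proof (intro allI impI)
    fix i assume "1 \<le> i" "i < n"
    then show "\<exists>m. 1 \<le> m \<and> m < k + 1 \<and> i = n - m" by (intro exI[of _ "n - i"]) (auto simp: n)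
  qed
  have shift_abs: "?t (fshift ?y) * ?t (fg (n-j)) = product_scale (- inverse q) (?t (fshift ?y))"
      "?t (fg (n-j)) * ?t (fshift ?y) = product_scale (- inverse q) (?t (fshift ?y))"
    if "1 \<le> j" "j < k" for j
    using S.A_absorbs[unfolded S.A_def p, rule_format, of "k - j"]
      S.A_left_absorbs[unfolded S.A_def p, rule_format, of "k - j"] that
    by (simp_all add: n Suc_diff_le)
  have y_abs: "?t ?y * ?t (fg j) = product_scale (- inverse q) (?t ?y)"
      "?t (fg j) * ?t ?y = product_scale (- inverse q) (?t ?y)" if "1 \<le> j" "j < k" for j
    using K.A_absorbs[rule_format, of j] K.A_left_absorbs[rule_format, of j] that
    by (simp_all add: K.A_def p)
  let ?sm = "bwm_smult r q n ?c" and ?A = "antisymmetrizer r q n"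
  have 1: "bwm_gamma r q n (symmetrizer r (- inverse q) n) = ?A"
    using antisymmetrizer_represents[OF params, of n] bwm_gamma_class[of _ n r q]
    by (simp add: symmetrizer_neg_inverse represents_def bwm_class_def bwm_ideal_neg_inverse)
  have 2: "?sm (bwm_embed r q n ?B \<otimes>\<^bsub>BWM r q n\<^esub> b_minus_k1 r q n k) = ?A"
  proof (rule right[where f = "\<lambda>i. i" and u = "?y"])
    show "\<forall>m. 1 \<le> m \<longrightarrow> m < k + 1 \<longrightarrow> ?t (?y) * recursion_factor product_scale (\<lambda>i. ?t (fg (i))) (\<lambda>i. ?t (fe (i))) r q k * ?t (fg (m)) =
        product_scale (- inverse q) (?t (?y) * recursion_factor product_scale (\<lambda>i. ?t (fg (i))) (\<lambda>i. ?t (fe (i))) r q k)"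
      by (rule E.recursion_factor_absorbs[where a = "?t ?y" and k = k, unfolded p])
        (use y_abs kn in \<open>auto simp: of_op_inject[symmetric] op_simps\<close>)
  qed (use id aug_y in \<open>auto intro!: represents_smult represents_mult embed represents_b_minus_k1[of r q k, folded n]\<close>)
  have 3: "?sm (bwm_shift r q n ?B \<otimes>\<^bsub>BWM r q n\<^esub> b_minus_1k r q n k) = ?A"
  proof (rule right[where f = "\<lambda>i. n - i" and u = "fshift ?y"])
    show "\<forall>m. 1 \<le> m \<longrightarrow> m < k + 1 \<longrightarrow> ?t (fshift ?y) * recursion_factor product_scale (\<lambda>i. ?t (fg (n - i))) (\<lambda>i. ?t (fe (n - i))) r q k * ?t (fg (n - m)) =
        product_scale (- inverse q) (?t (fshift ?y) * recursion_factor product_scale (\<lambda>i. ?t (fg (n - i))) (\<lambda>i. ?t (fe (n - i))) r q k)"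
      by (rule F.recursion_factor_absorbs[where a = "?t (fshift ?y)" and k = k, unfolded p])
        (use shift_abs kn in \<open>auto simp: of_op_inject[symmetric] op_simps\<close>)
  qed (use flip aug_shift in \<open>auto intro!: represents_smult represents_mult shift represents_b_minus_1k[of r q k, folded n]\<close>)
  have 4: "?sm (a_minus_k1 r q n k \<otimes>\<^bsub>BWM r q n\<^esub> bwm_embed r q n ?B) = ?A"
  proof (rule left[where f = "\<lambda>i. i" and u = "?y"])
    show "\<forall>m. 1 \<le> m \<longrightarrow> m < k + 1 \<longrightarrow> to_op (?t (?y)) * recursion_factor (op_scale product_scale) (\<lambda>i. to_op (?t (fg (i)))) (\<lambda>i. to_op (?t (fe (i)))) r q k
          * to_op (?t (fg (m))) =
        op_scale product_scale (- inverse q) (to_op (?t (?y)) *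
          recursion_factor (op_scale product_scale) (\<lambda>i. to_op (?t (fg (i)))) (\<lambda>i. to_op (?t (fe (i)))) r q k)"
      by (rule O.recursion_factor_absorbs[where a = "to_op (?t ?y)" and k = k, unfolded p])
        (use y_abs kn in \<open>auto simp: of_op_inject[symmetric] op_simps\<close>)
  qed (use id aug_y in \<open>auto intro!: represents_smult represents_mult embed represents_a_minus_k1[of r q k, folded n]\<close>)
  have 5: "?sm (a_minus_1k r q n k \<otimes>\<^bsub>BWM r q n\<^esub> bwm_shift r q n ?B) = ?A"
  proof (rule left[where f = "\<lambda>i. n - i" and u = "fshift ?y"])
    show "\<forall>m. 1 \<le> m \<longrightarrow> m < k + 1 \<longrightarrow> to_op (?t (fshift ?y)) * recursion_factor (op_scale product_scale) (\<lambda>i. to_op (?t (fg (n - i)))) (\<lambda>i. to_op (?t (fe (n - i)))) r q k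
          * to_op (?t (fg (n - m))) =
        op_scale product_scale (- inverse q) (to_op (?t (fshift ?y)) *
          recursion_factor (op_scale product_scale) (\<lambda>i. to_op (?t (fg (n - i)))) (\<lambda>i. to_op (?t (fe (n - i)))) r q k)"
      by (rule OF.recursion_factor_absorbs[where a = "to_op (?t (fshift ?y))" and k = k, unfolded p])
        (use shift_abs kn in \<open>auto simp: of_op_inject[symmetric] op_simps\<close>)
  qed (use flip aug_shift in \<open>auto intro!: represents_smult represents_mult shift represents_a_minus_1k[of r q k, folded n]\<close>)
  have k: "n - 1 = k" by (simp add: n)
  show ?thesis
    unfolding Let_def k using 1 2 3 4 5 by (simp add: n)
qed

end
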